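(* Let $a>0$ and let $\alpha\in\mathbb{F}_a$ satisfy $0\le\alpha\{0\}<a$. Then the probability distribution of $\tilde\gamma(I)=\int_{\mathbb{R}}x\,\tilde\gamma(dx)$ under $\mathscr{G}_\alpha$ is absolutely continuous with respect to the Lebesgue measure on $\mathbb{R}$, and $$q(x)=\mathbb{I}_{(-\infty,0]}(x)\,\frac{|x|^{a-1}}{\Gamma(a)}\int_{(-\infty,0)}|y|^{-a}e^{-x/y}\,\mu_\alpha(dy)+\mathbb{I}_{(0,+\infty)}(x)\,\frac{x^{a-1}}{\Gamma(a)}\int_{(0,+\infty)}y^{-a}e^{-x/y}\,\mu_\alpha(dy)$$ is a density function of this distribution.
   Context: For $a>0$, $\mathbb{F}_a$ is the set of finite measures $\alpha$ on $(\mathbb{R},\mathscr{B}(\mathbb{R}))$ with $\alpha(\mathbb{R})=a$ and $\int_{\mathbb{R}}\log(1+|x|)\,\alpha(dx)<+\infty$. $\mathbb{I}_B$ is the indicator function of $B$. Gamma process: $\mathscr{G}_\alpha$ is the law of a random finite measure $\tilde\gamma$ on $\mathbb{R}$ such that, for every finite measurable partition $\{B_1,\ldots,B_k\}$ of $\mathbb{R}$, the variables $\tilde\gamma(B_1),\ldots,\tilde\gamma(B_k)$ are independent and $\tilde\gamma(B_j)$ is gamma distributed with mean and variance both equal to $\alpha(B_j)$ (i.e. shape $\alpha(B_j)$, scale $1$; a.s. $0$ if $\alpha(B_j)=0$). Dirichlet process: a random probability measure $\tilde\varphi$ on $\mathbb{R}$ has law $\mathscr{D}_\alpha$ if, for every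 finite measurable partition $C_1,\ldots,C_{n+1}$ of $\mathbb{R}$, the vector $(\tilde\varphi(C_1),\ldots,\tilde\varphi(C_n))$ has the Dirichlet distribution with parameter $(\alpha(C_1),\ldots,\alpha(C_{n+1}))$ (components with $\alpha(C_i)=0$ being a.s. $0$). For $\alpha\in\mathbb{F}_a$, $\int|x|\,\tilde\varphi(dx)<\infty$ a.s. and $\mu_\alpha$ denotes the probability distribution of $\tilde\varphi(I)=\int_{\mathbb{R}}x\,\tilde\varphi(dx)$ under $\mathscr{D}_\alpha$. Likewise $\tilde\gamma(I)$ is a.s. well defined and finite. *)

theory Defs
  imports "HOL-Probability.Probability"
begin

definition log_integrable_measures :: "real \<Rightarrow> real measure set" where
  "log_integrable_measures a =
     {\<alpha>. finite_measure \<alpha> \<and> sets \<alpha> = sets borel \<and> measure \<alpha> UNIV = a \<and>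
         integrable \<alpha> (\<lambda>x. ln (1 + \<bar>x\<bar>))}"

(* Cells may be empty; an empty cell has mass zero under every measure involved. *)
definition measurable_partition :: "nat \<Rightarrow> (nat \<Rightarrow> real set) \<Rightarrow> bool" where
  "measurable_partition k B \<longleftrightarrow>
     (\<forall>i<k. B i \<in> sets borel) \<and> disjoint_family_on B {..<k} \<and> (\<Union>i<k. B i) = UNIV"

(* Shape s and scale 1, so that mean and variance are both s. *)
definition gamma_distribution :: "real \<Rightarrow> real measure" where
  "gamma_distribution s =
     (if s = 0 then return borel 0
      else density lborel
        (\<lambda>x. ennreal (indicator {0<..} x * (x powr (s - 1) * exp (- x) / Gamma s))))"

definition random_finite_measure :: "'w measure \<Rightarrow> ('w \<Rightarrow> real measure) \<Rightarrow> bool" where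
  "random_finite_measure P \<gamma> \<longleftrightarrow>
     (\<forall>\<omega>\<in>space P. finite_measure (\<gamma> \<omega>) \<and> sets (\<gamma> \<omega>) = sets borel) \<and>
     (\<forall>B\<in>sets borel. (\<lambda>\<omega>. measure (\<gamma> \<omega>) B) \<in> borel_measurable P)"

definition gamma_process :: "real measure \<Rightarrow> 'w measure \<Rightarrow> ('w \<Rightarrow> real measure) \<Rightarrow> bool" where
  "gamma_process \<alpha> P \<gamma> \<longleftrightarrow>
     prob_space P \<and> random_finite_measure P \<gamma> \<and>
     (\<forall>k B. measurable_partition k B \<longrightarrow>
        prob_space.indep_vars P (\<lambda>_. borel) (\<lambda>j \<omega>. measure (\<gamma> \<omega>) (B j)) {..<k} \<and>
        (\<forall>j<k. distr P borel (\<lambda>\<omega>. measure (\<gamma> \<omega>) (B j)) = gamma_distribution (measure \<alpha> (B j))))"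

(* Density on the coordinates J - {k}; coordinate k is one minus the sum of the others. *)
definition dirichlet_density :: "nat set \<Rightarrow> nat \<Rightarrow> (nat \<Rightarrow> real) \<Rightarrow> (nat \<Rightarrow> real) \<Rightarrow> real" where
  "dirichlet_density J k a x =
     (if (\<forall>j\<in>J - {k}. 0 < x j) \<and> (\<Sum>j\<in>J - {k}. x j) < 1
      then Gamma (\<Sum>j\<in>J. a j) / (\<Prod>j\<in>J. Gamma (a j)) *
           (\<Prod>j\<in>J - {k}. x j powr (a j - 1)) * (1 - (\<Sum>j\<in>J - {k}. x j)) powr (a k - 1)
      else 0)"

(* Law of the first n of the n + 1 components, with parameters a 0, ..., a n, not all zero.
   Components with parameter zero are set to 0, the others (indices J) have the usual Dirichlet
   density, where the last one, k, is determined by the rest.  If all parameters are positive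
   then k = n; see dirichlet_distribution_pos. *)
definition dirichlet_distribution :: "nat \<Rightarrow> (nat \<Rightarrow> real) \<Rightarrow> (nat \<Rightarrow> real) measure" where
  "dirichlet_distribution n a =
     (let J = {j. j \<le> n \<and> 0 < a j}; k = Max J in
      distr (density (\<Pi>\<^sub>M j\<in>J - {k}. lborel) (\<lambda>x. ennreal (dirichlet_density J k a x)))
        (\<Pi>\<^sub>M i\<in>{..<n}. borel)
        (\<lambda>x. \<lambda>i\<in>{..<n}. if i \<notin> J then 0 else if i = k then 1 - (\<Sum>j\<in>J - {k}. x j) else x i))"

lemma dirichlet_distribution_pos:
  assumes "\<And>j. j \<le> n \<Longrightarrow> 0 < a j"
  shows "dirichlet_distribution n a =
    density (\<Pi>\<^sub>M j\<in>{..<n}. lborel) (\<lambda>x. ennreal (dirichlet_density {..n} n a x))"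
proof -
  have J: "{j. j \<le> n \<and> 0 < a j} = {..n}"
    using assms by auto
  have k: "Max {..n} = n"
    by (intro Max_eqI) auto
  have I: "{..n} - {n} = {..<n}"
    by auto
  let ?D = "density (\<Pi>\<^sub>M j\<in>{..<n}. lborel :: real measure)
    (\<lambda>x. ennreal (dirichlet_density {..n} n a x))"
  have "dirichlet_distribution n a =
    distr ?D (\<Pi>\<^sub>M i\<in>{..<n}. borel)
      (\<lambda>x. \<lambda>i\<in>{..<n}. if i \<notin> {..n} then 0 else if i = n then 1 - (\<Sum>j<n. x j) else x i)"
    unfolding dirichlet_distribution_def Let_def J k I ..
  also have "\<dots> = distr ?D (\<Pi>\<^sub>M i\<in>{..<n}. borel) (\<lambda>x. x)"
    by (intro distr_cong) (auto simp: space_PiM PiE_def extensional_def fun_eq_iff)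
  also have "\<dots> = ?D"
    by (intro distr_id2) (auto intro!: sets_PiM_cong)
  finally show ?thesis .
qed

definition dirichlet_process :: "real measure \<Rightarrow> 'v measure \<Rightarrow> ('v \<Rightarrow> real measure) \<Rightarrow> bool" where
  "dirichlet_process \<alpha> Q \<phi> \<longleftrightarrow>
     prob_space Q \<and> \<phi> \<in> measurable Q (prob_algebra borel) \<and>
     (\<forall>n C. measurable_partition (Suc n) C \<longrightarrow>
        distr Q (\<Pi>\<^sub>M i\<in>{..<n}. borel) (\<lambda>\<omega>. \<lambda>i\<in>{..<n}. measure (\<phi> \<omega>) (C i)) =
          dirichlet_distribution n (\<lambda>i. measure \<alpha> (C i)))"

(* The Lebesgue integral is 0 by convention where the identity is not integrable;
   for the processes at hand this is a null event. *)
definition mean_functional :: "real measure \<Rightarrow> real" where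
  "mean_functional m = (LINT x|m. x)"

(* The law of the mean of the Dirichlet process, computed from a realization \<phi> on Q. *)
definition dirichlet_mean_law :: "'v measure \<Rightarrow> ('v \<Rightarrow> real measure) \<Rightarrow> real measure" where
  "dirichlet_mean_law Q \<phi> = distr Q borel (\<lambda>\<omega>. mean_functional (\<phi> \<omega>))"

definition gamma_mean_density :: "real \<Rightarrow> real measure \<Rightarrow> real \<Rightarrow> real" where
  "gamma_mean_density a \<mu> x =
     indicator {..0} x * (\<bar>x\<bar> powr (a - 1) / Gamma a) *
       (LINT y:{..<0}|\<mu>. \<bar>y\<bar> powr (- a) * exp (- x / y)) +
     indicator {0<..} x * (x powr (a - 1) / Gamma a) *
       (LINT y:{0<..}|\<mu>. y powr (- a) * exp (- x / y))"

end

theory Submission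
  imports Defs
begin

text \<open>
  The proof rests on the gamma-Dirichlet algebra: a gamma process is its total mass, which is
  gamma distributed with shape \<open>a\<close>, times an independent Dirichlet process.  Hence
  \<open>\<gamma>(I)\<close> has the law of \<open>T * \<phi>(I)\<close> with \<open>T\<close> gamma distributed and independent of
  \<open>\<phi>\<close> (\<open>gamma_mean_law\<close>).  For a fixed \<open>y \<noteq> 0\<close> the variable \<open>T * y\<close> has an explicit density, and
  mixing these densities over the law \<open>\<mu>\<close> of \<open>\<phi>(I)\<close> gives the asserted formula
  (\<open>distr_scaled_gamma_eq_density\<close>), provided that \<open>\<mu>\<close> has no atom at \<open>0\<close>: such an atom would
  reappear as an atom of \<open>\<gamma>(I)\<close>.

  On finitely many cells the factorization is a change of variables in a product of gamma densities
  (\<open>gamma_product_polar\<close>), which gives the identity in law for simple functions in place of \<open>I\<close>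
  (\<open>gamma_law_simple_function\<close>).  The passage to \<open>I\<close> needs \<open>\<integral>|x| d\<gamma> < \<infinity>\<close> and
  \<open>\<integral>|x| d\<phi> < \<infinity>\<close> almost surely.  Both follow from the Laplace transform
  \<open>E exp (-\<gamma>(r)) = exp (-\<integral>ln (1 + r) d\<alpha>)\<close>, since the logarithmic integrability of \<open>\<alpha>\<close> bounds
  \<open>E exp (-l \<gamma>(|f|))\<close> from below, uniformly in the simple functions \<open>|f| \<le> 2 |x|\<close>, by a quantity that tends
  to \<open>1\<close> as \<open>l\<close> tends to \<open>0\<close>.

  That \<open>\<gamma>(I)\<close> has no atom at \<open>0\<close> follows from the quasi-invariance of the gamma process: dividing
  \<open>\<gamma>\<close> by \<open>1 + r\<close>, with \<open>r \<ge> 0\<close>, has the same effect on the law as weighting the underlying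
  probability with the positive density \<open>exp (\<integral>ln (1 + r) d\<alpha> - \<gamma>(r))\<close>.  As \<open>\<alpha>\<close> is not
  concentrated at \<open>0\<close>, one of the half-lines \<open>B\<close> to the left and to the right of \<open>0\<close> has positive
  \<open>\<alpha>\<close>-mass.  Take \<open>r\<close> constant on \<open>B\<close> and \<open>0\<close> elsewhere.
  Rescaling turns \<open>\<gamma>(I)\<close> into \<open>\<gamma>(I) - \<theta> U\<close>, where \<open>U \<noteq> 0\<close> is the contribution of
  \<open>B\<close> and \<open>\<theta>\<close> is any prescribed number in the open unit interval.  The variable
  \<open>\<gamma>(I) / U\<close> has at most countably many atoms, so for some \<open>\<theta>\<close> the rescaled mean is almost surely
  nonzero, and then so is \<open>\<gamma>(I)\<close>, because the two laws are related by a positive weight.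
\<close>

section \<open>Integrals against random measures\<close>

lemma nn_integral_random_measure_measurable:
  assumes rm: "random_finite_measure P \<gamma>" and f: "f \<in> borel_measurable borel"
  shows "(\<lambda>\<omega>. \<integral>\<^sup>+x. f x \<partial>\<gamma> \<omega>) \<in> borel_measurable P"
proof -
  have sets: "sets (\<gamma> \<omega>) = sets borel" if "\<omega> \<in> space P" for \<omega>
    using rm that by (auto simp: random_finite_measure_def)
  have fin: "finite_measure (\<gamma> \<omega>)" if "\<omega> \<in> space P" for \<omega>
    using rm that by (auto simp: random_finite_measure_def)
  have mb: "g \<in> borel_measurable (\<gamma> \<omega>)" if "g \<in> borel_measurable borel" "\<omega> \<in> space P"
    for g :: "real \<Rightarrow> ennreal" and \<omega>
    using that measurable_cong_sets[OF sets[OF that(2)] refl] by blast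
  show ?thesis
    using f
  proof (induction rule: borel_measurable_induct)
    case (cong f g)
    have "f = g" using cong(3) by auto
    then show ?case using cong by simp
  next
    case (set A)
    have "(\<lambda>\<omega>. ennreal (measure (\<gamma> \<omega>) A)) \<in> borel_measurable P"
      using rm set by (auto simp: random_finite_measure_def)
    then show ?case
      by (rule measurable_cong[THEN iffD1, rotated])
         (use set sets in \<open>simp add: finite_measure.emeasure_eq_measure[OF fin]\<close>)
  next
    case (mult u c)
    have "(\<lambda>\<omega>. c * (\<integral>\<^sup>+x. u x \<partial>\<gamma> \<omega>)) \<in> borel_measurable P"
      using mult by auto
    then show ?case
      by (rule measurable_cong[THEN iffD1, rotated]) (rule nn_integral_cmult[symmetric], use mult mb in blast)
  next
    case (add u v)
    have "(\<lambda>\<omega>. (\<integral>\<^sup>+x. v x \<partial>\<gamma> \<omega>) + (\<integral>\<^sup>+x. u x \<partial>\<gamma> \<omega>)) \<in> borel_measurable P"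
      using add by auto
    then show ?case
      by (rule measurable_cong[THEN iffD1, rotated]) (rule nn_integral_add[symmetric]; use add mb in blast)
  next
    case (seq U)
    have "(\<lambda>\<omega>. SUP i. (\<integral>\<^sup>+x. U i x \<partial>\<gamma> \<omega>)) \<in> borel_measurable P"
      using seq by auto
    moreover have "(SUP i. (\<integral>\<^sup>+x. U i x \<partial>\<gamma> \<omega>)) = (\<integral>\<^sup>+x. (SUP i. U i) x \<partial>\<gamma> \<omega>)"
      if "\<omega> \<in> space P" for \<omega>
      unfolding SUP_apply
      by (rule nn_integral_monotone_convergence_SUP[symmetric])
         (use \<open>incseq U\<close> \<open>\<And>i. U i \<in> borel_measurable borel\<close> mb that in blast)+
    ultimately show ?case
      by (rule measurable_cong[THEN iffD1, rotated])
  qed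
qed

lemma integral_random_measure_measurable:
  fixes f :: "real \<Rightarrow> real"
  assumes rm: "random_finite_measure P \<gamma>" and f[measurable]: "f \<in> borel_measurable borel"
  shows "(\<lambda>\<omega>. LINT x|\<gamma> \<omega>. f x) \<in> borel_measurable P"
    and "Measurable.pred P (\<lambda>\<omega>. integrable (\<gamma> \<omega>) f)"
proof -
  have mf: "f \<in> borel_measurable (\<gamma> \<omega>)" if "\<omega> \<in> space P" for \<omega>
    using rm that f measurable_cong_sets[of "\<gamma> \<omega>" borel borel borel]
    by (auto simp: random_finite_measure_def)
  have [measurable]: "(\<lambda>\<omega>. \<integral>\<^sup>+x. ennreal (norm (f x)) \<partial>\<gamma> \<omega>) \<in> borel_measurable P"
    "(\<lambda>\<omega>. \<integral>\<^sup>+x. ennreal (f x) \<partial>\<gamma> \<omega>) \<in> borel_measurable P"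
    "(\<lambda>\<omega>. \<integral>\<^sup>+x. ennreal (- f x) \<partial>\<gamma> \<omega>) \<in> borel_measurable P"
    by (intro nn_integral_random_measure_measurable[OF rm]; measurable)+
  have "Measurable.pred P (\<lambda>\<omega>. (\<integral>\<^sup>+x. ennreal (norm (f x)) \<partial>\<gamma> \<omega>) < \<infinity>)"
    by measurable
  then show int[measurable]: "Measurable.pred P (\<lambda>\<omega>. integrable (\<gamma> \<omega>) f)"
    by (rule measurable_cong[THEN iffD1, rotated]) (use mf in \<open>auto simp: integrable_iff_bounded\<close>)
  have "(\<lambda>\<omega>. if integrable (\<gamma> \<omega>) f
       then enn2real (\<integral>\<^sup>+x. ennreal (f x) \<partial>\<gamma> \<omega>) - enn2real (\<integral>\<^sup>+x. ennreal (- f x) \<partial>\<gamma> \<omega>) else 0)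
     \<in> borel_measurable P"
    by measurable
  then show "(\<lambda>\<omega>. LINT x|\<gamma> \<omega>. f x) \<in> borel_measurable P"
    by (rule measurable_cong[THEN iffD1, rotated])
       (auto simp: real_lebesgue_integral_def not_integrable_integral_eq)
qed

text \<open>
  The finite-dimensional laws of the processes are given on partitions.  A common partition for two
  simple functions brings their integrals under these laws.  Cells are nonempty so that sign
  conditions on the functions pass to their values.
\<close>

lemma simple_functions_partition:
  fixes f r :: "real \<Rightarrow> real"
  assumes f: "simple_function borel f" and r: "simple_function borel r"
  obtains k C c d where "measurable_partition k C"
    "\<And>j x. j < k \<Longrightarrow> x \<in> C j \<Longrightarrow> f x = c j \<and> r x = d j"
    "\<And>j. j < k \<Longrightarrow> C j \<noteq> {}"
proof -
  let ?g = "\<lambda>x. (f x, r x)"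
  have g: "simple_function borel ?g"
    using f r by (rule simple_function_Pair)
  then have fin: "finite (range ?g)"
    by (auto simp: simple_function_def)
  then obtain e where e: "bij_betw e {..<card (range ?g)} (range ?g)"
    using ex_bij_betw_nat_finite by (auto simp: atLeast0LessThan)
  define C where "C j = ?g -` {e j}" for j
  have inj: "i = j" if "e i = e j" "i < card (range ?g)" "j < card (range ?g)" for i j
    using e that unfolding bij_betw_def inj_on_def by auto
  show thesis
  proof (rule that)
    show "measurable_partition (card (range ?g)) C"
      unfolding measurable_partition_def
    proof (intro conjI allI impI)
      fix i
      show "C i \<in> sets borel"
        using simple_functionD(2)[OF g, of "{e i}"] by (simp add: C_def)
    next
      show "disjoint_family_on C {..<card (range ?g)}"
        using inj by (auto simp: disjoint_family_on_def C_def)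
    next
      have "\<exists>j<card (range ?g). x \<in> C j" for x
      proof -
        have "?g x \<in> e ` {..<card (range ?g)}"
          using e by (auto simp: bij_betw_def)
        then show ?thesis
          by (auto simp: C_def)
      qed
      then show "(\<Union>i<card (range ?g). C i) = UNIV"
        by auto
    qed
  next
    fix j x assume "x \<in> C j"
    then show "f x = fst (e j) \<and> r x = snd (e j)"
      by (metis C_def vimage_singleton_eq fst_conv snd_conv)
  next
    fix j assume "j < card (range ?g)"
    then have "e j \<in> range ?g"
      using e by (auto simp: bij_betw_def)
    then show "C j \<noteq> {}"
      by (auto simp: C_def)
  qed
qed

lemma integral_on_partition:
  fixes f :: "real \<Rightarrow> real"
  assumes M: "finite_measure M" "sets M = sets borel" and C: "measurable_partition k C"
    and f: "\<And>j x. j < k \<Longrightarrow> x \<in> C j \<Longrightarrow> f x = c j"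
  shows "integrable M f" "(LINT x|M. f x) = (\<Sum>j<k. c j * measure M (C j))"
proof -
  interpret finite_measure M by fact
  have sets: "C j \<in> sets M" if "j < k" for j
    using C M that by (auto simp: measurable_partition_def)
  have eq: "f = (\<lambda>x. \<Sum>j<k. c j * indicator (C j) x)"
  proof
    fix x
    have "x \<in> (\<Union>i<k. C i)"
      using C by (simp add: measurable_partition_def)
    then obtain j where j: "j < k" "x \<in> C j"
      by blast
    have "(\<Sum>i<k. c i * indicator (C i) x) = (\<Sum>i<k. if i = j then c j else 0)"
    proof (rule sum.cong)
      fix i assume "i \<in> {..<k}"
      then have "i = j \<or> C i \<inter> C j = {}"
        using C j by (auto simp: measurable_partition_def disjoint_family_on_def)
      then show "c i * indicator (C i) x = (if i = j then c j else 0)"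
        using j by (auto simp: indicator_def)
    qed simp
    then show "f x = (\<Sum>j<k. c j * indicator (C j) x)"
      using f[OF j] j by simp
  qed
  have ic: "integrable M (\<lambda>x. c j * indicator (C j) x :: real)" if "j < k" for j
    using sets[OF that] by (auto intro!: integrable_mult_right integrable_real_indicator simp: emeasure_eq_measure)
  show "integrable M f"
    unfolding eq using ic by (intro Bochner_Integration.integrable_sum) auto
  show "(LINT x|M. f x) = (\<Sum>j<k. c j * measure M (C j))"
    unfolding eq using ic sets
    by (subst Bochner_Integration.integral_sum) (auto intro!: sum.cong simp: emeasure_eq_measure)
qed

section \<open>Gamma distributions\<close>

definition gamma_density :: "real \<Rightarrow> real \<Rightarrow> real" where
  "gamma_density s x = indicator {0<..} x * (x powr (s - 1) * exp (- x) / Gamma s)"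

lemma gamma_density_measurable[measurable]: "gamma_density s \<in> borel_measurable borel"
  unfolding gamma_density_def by measurable

lemma gamma_density_nonneg: "0 < s \<Longrightarrow> 0 \<le> gamma_density s x"
  by (auto simp: gamma_density_def)

lemma gamma_distribution_eq_density:
  "0 < s \<Longrightarrow> gamma_distribution s = density lborel (\<lambda>x. ennreal (gamma_density s x))"
  by (simp add: gamma_distribution_def gamma_density_def)

lemma gamma_distribution_0: "gamma_distribution 0 = return borel 0"
  by (simp add: gamma_distribution_def)

lemma sets_gamma_distribution[measurable_cong, simp]: "sets (gamma_distribution s) = sets borel"
  by (simp add: gamma_distribution_def)

lemma space_gamma_distribution[simp]: "space (gamma_distribution s) = UNIV"
  by (simp add: gamma_distribution_def)

lemma prob_space_gamma_distribution:
  assumes "0 \<le> s"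
  shows "prob_space (gamma_distribution s)"
proof (cases "s = 0")
  case True
  then show ?thesis by (auto simp: gamma_distribution_0 intro: prob_space_return)
next
  case False
  with assms have s: "0 < s" by simp
  have "emeasure (gamma_distribution s) UNIV = (\<integral>\<^sup>+x. ennreal (gamma_density s x) \<partial>lborel)"
    by (simp add: gamma_distribution_eq_density[OF s] emeasure_density)
  also have "\<dots> = (\<integral>\<^sup>+x. ennreal (1 / Gamma s) * ennreal (indicator {0..} x * x powr (s - 1) / exp x) \<partial>lborel)"
  proof (rule nn_integral_cong_AE)
    have "AE x in lborel. x \<noteq> (0::real)"
      by (rule AE_lborel_singleton)
    then show "AE x in lborel. ennreal (gamma_density s x) =
      ennreal (1 / Gamma s) * ennreal (indicator {0..} x * x powr (s - 1) / exp x)"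
    proof eventually_elim
      case (elim x)
      have "gamma_density s x = 1 / Gamma s * (indicator {0..} x * x powr (s - 1) / exp x)"
        using elim by (simp add: gamma_density_def indicator_def exp_minus divide_inverse mult_ac)
      then show ?case
        using Gamma_real_pos[OF s] by (subst ennreal_mult'[symmetric]) auto
    qed
  qed
  also have "\<dots> = ennreal (1 / Gamma s) * ennreal (Gamma s)"
    using s by (subst nn_integral_cmult) (auto simp: Gamma_conv_nn_integral_real)
  also have "\<dots> = 1"
    using Gamma_real_pos[OF s] by (subst ennreal_mult'[symmetric]) auto
  finally show ?thesis
    by (intro prob_spaceI) simp
qed

lemma AE_gamma_distribution_pos:
  assumes "0 < s"
  shows "AE t in gamma_distribution s. 0 < t"
  unfolding gamma_distribution_eq_density[OF assms]
  by (subst AE_density) (auto simp: gamma_density_def indicator_def)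

text \<open>
  Scaling a gamma variable down is the same as exponential tilting.  Total mass \<open>1\<close> of the left-hand
  side makes this the Laplace transform of the gamma distribution as well.
\<close>

lemma distr_gamma_distribution_scale:
  assumes "0 \<le> s" and r: "0 \<le> r"
  shows "distr (gamma_distribution s) borel (\<lambda>x. x / (1 + r)) =
    density (gamma_distribution s) (\<lambda>x. ennreal ((1 + r) powr s * exp (- r * x)))"
proof (cases "s = 0")
  case True
  then show ?thesis
    using r by (intro measure_eqI)
      (auto simp: gamma_distribution_0 distr_return emeasure_density nn_integral_return)
next
  case False
  with assms have s: "0 < s" by simp
  show ?thesis
  proof (rule measure_eqI)
    fix A assume "A \<in> sets (distr (gamma_distribution s) borel (\<lambda>x. x / (1 + r)))"
    then have A[measurable]: "A \<in> sets borel" by simp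
    have "emeasure (distr (gamma_distribution s) borel (\<lambda>x. x / (1 + r))) A =
      (\<integral>\<^sup>+x. indicator A x \<partial>distr (gamma_distribution s) borel (\<lambda>x. x / (1 + r)))"
      by simp
    also have "\<dots> = (\<integral>\<^sup>+x. ennreal (gamma_density s x) * indicator A (x / (1 + r)) \<partial>lborel)"
      using s by (simp add: nn_integral_distr gamma_distribution_eq_density[OF s] nn_integral_density del: nn_integral_indicator)
    also have "\<dots> = ennreal \<bar>1 + r\<bar> *
        (\<integral>\<^sup>+x. ennreal (gamma_density s (0 + (1 + r) * x)) * indicator A ((0 + (1 + r) * x) / (1 + r)) \<partial>lborel)"
      using r by (intro nn_integral_real_affine) auto
    also have "\<dots> = (\<integral>\<^sup>+x. ennreal (1 + r) * (ennreal (gamma_density s ((1 + r) * x)) * indicator A x) \<partial>lborel)"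
      using r by (subst nn_integral_cmult) auto
    also have "\<dots> = (\<integral>\<^sup>+x. ennreal (gamma_density s x) * (ennreal ((1 + r) powr s * exp (- r * x)) * indicator A x) \<partial>lborel)"
    proof (rule nn_integral_cong)
      fix x :: real
      have p: "(1 + r) * (1 + r) powr (s - 1) = (1 + r) powr s"
        using r by (simp add: powr_diff)
      have "(1 + r) * gamma_density s ((1 + r) * x) = gamma_density s x * ((1 + r) powr s * exp (- r * x))"
      proof (cases "0 < x")
        case True
        have "(1 + r) * gamma_density s ((1 + r) * x) =
          ((1 + r) * (1 + r) powr (s - 1)) * x powr (s - 1) * exp (- ((1 + r) * x)) / Gamma s"
          using True r by (simp add: gamma_density_def powr_mult)
        also have "exp (- ((1 + r) * x)) = exp (- x) * exp (- r * x)"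
          by (simp add: exp_add[symmetric] algebra_simps)
        finally show ?thesis
          using True unfolding p by (simp add: gamma_density_def mult_ac)
      next
        case False
        then show ?thesis
          using r by (simp add: gamma_density_def zero_less_mult_iff)
      qed
      then have "ennreal (1 + r) * ennreal (gamma_density s ((1 + r) * x)) =
          ennreal (gamma_density s x) * ennreal ((1 + r) powr s * exp (- r * x))"
        using r gamma_density_nonneg[OF s] by (metis ennreal_mult' add_nonneg_nonneg zero_le_one)
      then show "ennreal (1 + r) * (ennreal (gamma_density s ((1 + r) * x)) * indicator A x) =
          ennreal (gamma_density s x) * (ennreal ((1 + r) powr s * exp (- r * x)) * indicator A x)"
        by (simp add: mult.assoc[symmetric])
    qed
    also have "\<dots> = emeasure (density (gamma_distribution s) (\<lambda>x. ennreal ((1 + r) powr s * exp (- r * x)))) A"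
      by (simp add: gamma_distribution_eq_density[OF s] emeasure_density nn_integral_density)
    finally show "emeasure (distr (gamma_distribution s) borel (\<lambda>x. x / (1 + r))) A =
      emeasure (density (gamma_distribution s) (\<lambda>x. ennreal ((1 + r) powr s * exp (- r * x)))) A" .
  qed simp
qed

section \<open>The gamma-Dirichlet algebra\<close>

lemma nn_integral_PiM_lborel_scale:
  fixes t :: real
  assumes J: "finite J" and t: "0 < t"
    and F[measurable]: "F \<in> borel_measurable (\<Pi>\<^sub>M j\<in>J. lborel)"
  shows "(\<integral>\<^sup>+y. F y \<partial>(\<Pi>\<^sub>M j\<in>J. lborel)) =
    ennreal (t ^ card J) * (\<integral>\<^sup>+x. F (\<lambda>j\<in>J. t * x j) \<partial>(\<Pi>\<^sub>M j\<in>J. lborel))"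
proof -
  interpret L: product_sigma_finite "\<lambda>_::'a. lborel :: real measure"
    by standard
  let ?L = "\<Pi>\<^sub>M j\<in>J. (lborel :: real measure)"
  let ?s = "\<lambda>x. \<lambda>j\<in>J. t * x j"
  have [measurable]: "?s \<in> measurable ?L ?L"
    by (intro measurable_restrict) auto
  have scale: "ennreal t * emeasure lborel ((*) t -` A) = emeasure lborel A" if "A \<in> sets borel" for A
  proof -
    note that[measurable]
    have m: "(*) t -` A \<in> sets borel"
      using measurable_sets[of "(*) t" borel borel A] that by simp
    have "emeasure lborel A = ennreal \<bar>t\<bar> * (\<integral>\<^sup>+x. indicator A (0 + t * x) \<partial>lborel)"
      using t by (subst nn_integral_real_affine[symmetric]) auto
    also have "(\<lambda>x. indicator A (0 + t * x) :: ennreal) = indicator ((*) t -` A)"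
      by (auto simp: indicator_def fun_eq_iff)
    finally show ?thesis
      using t m by simp
  qed
  have "density (distr ?L ?L ?s) (\<lambda>_. ennreal (t ^ card J)) = ?L"
  proof (rule L.PiM_eqI)
    show "finite J" by fact
  next
    fix A :: "'a \<Rightarrow> real set" assume A: "\<And>i. i \<in> J \<Longrightarrow> A i \<in> sets lborel"
    have box: "Pi\<^sub>E J A \<in> sets ?L"
      using A J by (intro sets_PiM_I_finite) auto
    have pre: "?s -` Pi\<^sub>E J A \<inter> space ?L = (\<Pi>\<^sub>E j\<in>J. (*) t -` A j)"
      by (auto simp: space_PiM PiE_def Pi_def extensional_def)
    have "emeasure (density (distr ?L ?L ?s) (\<lambda>_. ennreal (t ^ card J))) (Pi\<^sub>E J A)
      = ennreal (t ^ card J) * emeasure ?L (\<Pi>\<^sub>E j\<in>J. (*) t -` A j)"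
      using box by (simp add: emeasure_density_const emeasure_distr pre)
    also have "\<dots> = (\<Prod>j\<in>J. ennreal t) * (\<Prod>j\<in>J. emeasure lborel ((*) t -` A j))"
      using A J t measurable_sets[of "(*) t" borel borel]
      by (subst L.emeasure_PiM) (auto simp: ennreal_power)
    also have "\<dots> = (\<Prod>j\<in>J. emeasure lborel (A j))"
      using A by (subst prod.distrib[symmetric]) (auto intro!: prod.cong scale)
    finally show "emeasure (density (distr ?L ?L ?s) (\<lambda>_. ennreal (t ^ card J))) (Pi\<^sub>E J A) =
      (\<Prod>i\<in>J. emeasure lborel (A i))" .
  qed simp
  then have "(\<integral>\<^sup>+y. F y \<partial>?L) = (\<integral>\<^sup>+y. F y \<partial>density (distr ?L ?L ?s) (\<lambda>_. ennreal (t ^ card J)))"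
    by simp
  also have "\<dots> = ennreal (t ^ card J) * (\<integral>\<^sup>+x. F (?s x) \<partial>?L)"
    by (simp add: nn_integral_density nn_integral_distr nn_integral_cmult)
  finally show ?thesis .
qed

text \<open>
  The pointwise identity behind the change of variables from independent gamma variables
  \<open>y\<^sub>j\<close> to their sum \<open>t\<close> and the proportions \<open>x\<^sub>j = y\<^sub>j / t\<close>: the factor
  \<open>t ^ card (J - {k})\<close> is the Jacobian, and the exponents of \<open>t\<close> add up to the shape of the sum.
\<close>

lemma gamma_densities_polar:
  assumes J: "finite J" "k \<in> J" and a: "\<And>j. j \<in> J \<Longrightarrow> 0 < a j" and t: "0 < t"
  shows "t ^ card (J - {k}) *
      ((\<Prod>j\<in>J - {k}. gamma_density (a j) (t * x j)) * gamma_density (a k) (t - (\<Sum>j\<in>J - {k}. t * x j))) =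
    gamma_density (\<Sum>j\<in>J. a j) t * dirichlet_density J k a x"
proof (cases "(\<forall>j\<in>J - {k}. 0 < x j) \<and> (\<Sum>j\<in>J - {k}. x j) < 1")
  case True
  let ?I = "J - {k}" and ?S = "\<Sum>j\<in>J - {k}. x j" and ?s = "\<Sum>j\<in>J. a j"
  have fI: "finite ?I" using J by simp
  have s: "?s = a k + (\<Sum>j\<in>?I. a j)"
    using J by (simp add: sum.remove)
  have spos: "0 < ?s"
    using J a by (intro sum_pos) auto
  have G: "Gamma ?s \<noteq> 0"
    using Gamma_real_pos[OF spos] by simp
  have rest: "t - (\<Sum>j\<in>?I. t * x j) = t * (1 - ?S)"
    by (simp add: sum_distrib_left[symmetric] algebra_simps)
  have "(\<Prod>j\<in>?I. gamma_density (a j) (t * x j)) =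
      (\<Prod>j\<in>?I. t powr (a j - 1) * x j powr (a j - 1) * exp (- (t * x j)) / Gamma (a j))"
    using True t by (intro prod.cong) (auto simp: gamma_density_def powr_mult)
  also have "\<dots> = t powr (\<Sum>j\<in>?I. a j - 1) * (\<Prod>j\<in>?I. x j powr (a j - 1)) *
      exp (- (t * ?S)) / (\<Prod>j\<in>?I. Gamma (a j))"
    using t fI by (simp add: prod.distrib prod_dividef powr_sum exp_sum[symmetric] sum_negf sum_distrib_left)
  finally have 1: "(\<Prod>j\<in>?I. gamma_density (a j) (t * x j)) =
      t powr (\<Sum>j\<in>?I. a j - 1) * (\<Prod>j\<in>?I. x j powr (a j - 1)) *
      exp (- (t * ?S)) / (\<Prod>j\<in>?I. Gamma (a j))" .
  have 2: "gamma_density (a k) (t * (1 - ?S)) =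
     t powr (a k - 1) * (1 - ?S) powr (a k - 1) * exp (- (t * (1 - ?S))) / Gamma (a k)"
    using True t by (auto simp: gamma_density_def powr_mult)
  have 3: "t ^ card ?I * t powr (\<Sum>j\<in>?I. a j - 1) * t powr (a k - 1) = t powr (?s - 1)"
    using t unfolding s
    by (simp add: sum_subtractf powr_realpow[symmetric] powr_add[symmetric] algebra_simps)
  have 4: "exp (- (t * ?S)) * exp (- (t * (1 - ?S))) = exp (- t)"
    by (simp add: exp_add[symmetric] algebra_simps)
  have 5: "(\<Prod>j\<in>J. Gamma (a j)) = (\<Prod>j\<in>?I. Gamma (a j)) * Gamma (a k)"
    using J by (simp add: prod.remove)
  have "t ^ card ?I * ((\<Prod>j\<in>?I. gamma_density (a j) (t * x j)) * gamma_density (a k) (t * (1 - ?S))) =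
     (t ^ card ?I * t powr (\<Sum>j\<in>?I. a j - 1) * t powr (a k - 1)) *
     (exp (- (t * ?S)) * exp (- (t * (1 - ?S)))) *
     (\<Prod>j\<in>?I. x j powr (a j - 1)) * (1 - ?S) powr (a k - 1) /
     ((\<Prod>j\<in>?I. Gamma (a j)) * Gamma (a k))"
    unfolding 1 2 by (simp add: mult_ac)
  also have "\<dots> = gamma_density ?s t * dirichlet_density J k a x"
    unfolding 3 4 5[symmetric] using True t G by (simp add: gamma_density_def dirichlet_density_def)
  finally show ?thesis
    unfolding rest .
next
  case False
  have "(\<Prod>j\<in>J - {k}. gamma_density (a j) (t * x j)) * gamma_density (a k) (t - (\<Sum>j\<in>J - {k}. t * x j)) = 0"
  proof (cases "\<forall>j\<in>J - {k}. 0 < x j")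
    case True
    with False have "\<not> 0 < t * (1 - (\<Sum>j\<in>J - {k}. x j))"
      using t by (simp add: zero_less_mult_iff)
    also have "t * (1 - (\<Sum>j\<in>J - {k}. x j)) = t - (\<Sum>j\<in>J - {k}. t * x j)"
      by (simp add: sum_distrib_left[symmetric] algebra_simps)
    finally show ?thesis
      by (simp add: gamma_density_def)
  next
    case False
    then obtain j where "j \<in> J - {k}" "\<not> 0 < x j" by blast
    then have "(\<Prod>j\<in>J - {k}. gamma_density (a j) (t * x j)) = 0"
      using t J by (intro prod_zero) (auto simp: gamma_density_def zero_less_mult_iff intro!: bexI[of _ j])
    then show ?thesis by simp
  qed
  moreover have "dirichlet_density J k a x = 0"
    unfolding dirichlet_density_def by (rule if_not_P[OF False])
  ultimately show ?thesis by (simp only: mult_zero_right)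
qed

lemma dirichlet_density_measurable[measurable]:
  assumes "finite J"
  shows "dirichlet_density J k a \<in> borel_measurable (\<Pi>\<^sub>M j\<in>J - {k}. lborel)"
proof -
  have [measurable]: "Measurable.pred (\<Pi>\<^sub>M j\<in>J - {k}. lborel) (\<lambda>x. \<forall>j\<in>J - {k}. 0 < (x j :: real))"
    using assms by measurable
  show ?thesis
    unfolding dirichlet_density_def by measurable
qed

text \<open>
  Independent gamma variables are a gamma distributed total times independent proportions.  Testing
  against product functions is enough, since boxes determine a product measure.  The coordinate
  \<open>k\<close> is first translated, which turns it into the total \<open>t\<close>; after Fubini the other
  coordinates are scaled by \<open>t\<close>.
\<close>

lemma gamma_product_polar:
  fixes h :: "nat \<Rightarrow> real \<Rightarrow> ennreal"
  assumes J: "finite J" "k \<in> J" and a: "\<And>j. j \<in> J \<Longrightarrow> 0 < a j"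
    and h: "\<And>j. j \<in> J \<Longrightarrow> h j \<in> borel_measurable borel"
  shows "(\<Prod>j\<in>J. \<integral>\<^sup>+y. h j y \<partial>gamma_distribution (a j)) =
    (\<integral>\<^sup>+t. \<integral>\<^sup>+x. ennreal (dirichlet_density J k a x) *
        (\<Prod>j\<in>J. h j (t * (if j = k then 1 - (\<Sum>j\<in>J - {k}. x j) else x j)))
      \<partial>(\<Pi>\<^sub>M j\<in>J - {k}. lborel) \<partial>gamma_distribution (\<Sum>j\<in>J. a j))"
proof -
  let ?I = "J - {k}" and ?s = "\<Sum>j\<in>J. a j"
  let ?L = "\<Pi>\<^sub>M j\<in>J - {k}. (lborel :: real measure)"
  interpret L: product_sigma_finite "\<lambda>_::nat. lborel :: real measure"
    by standard
  have fI: "finite ?I" using J by simp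
  interpret LI: finite_product_sigma_finite "\<lambda>_::nat. lborel :: real measure" ?I
    by standard (rule fI)
  interpret PL: pair_sigma_finite ?L "lborel :: real measure"
    by standard
  have [measurable]: "h j \<in> borel_measurable borel" if "j \<in> ?I" for j
    using h that by auto
  have [measurable]: "h k \<in> borel_measurable borel"
    using h J by auto
  have spos: "0 < ?s"
    using J a by (intro sum_pos) auto
  \<comment> \<open>Test function times gamma density, so that all integrals are over Lebesgue measure.\<close>
  define g where "g j y = h j y * ennreal (gamma_density (a j) y)" for j y
  have g: "g j \<in> borel_measurable borel" if "j \<in> J" for j
    using h[OF that] unfolding g_def by (intro borel_measurable_times_ennreal) auto
  have [measurable]: "g k \<in> borel_measurable borel"
    using g J by auto
  have [measurable]: "g j \<in> borel_measurable borel" if "j \<in> ?I" for j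
    using g that by auto
  have gint: "(\<integral>\<^sup>+y. h j y \<partial>gamma_distribution (a j)) = (\<integral>\<^sup>+y. g j y \<partial>lborel)" if "j \<in> J" for j
    using a[OF that] h[OF that] by (simp add: gamma_distribution_eq_density nn_integral_density g_def mult.commute)
  have H: "(\<Prod>j\<in>J. h j (t * (if j = k then 1 - (\<Sum>j\<in>?I. x j) else x j))) =
      (\<Prod>j\<in>?I. h j (t * x j)) * h k (t * (1 - (\<Sum>j\<in>?I. x j)))" for t and x :: "nat \<Rightarrow> real"
    unfolding prod.remove[OF J] by (subst mult.commute) (auto intro!: arg_cong2[where f = "(*)"] prod.cong)
  have gneg: "g j y = 0" if "y \<le> 0" for j y
    using that by (simp add: g_def gamma_density_def)
  have prodm[measurable]: "(\<lambda>y. \<Prod>j\<in>?I. g j (y j)) \<in> borel_measurable ?L"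
    using g by (intro borel_measurable_prod_ennreal measurable_compose[OF measurable_component_singleton]) auto
  have "(\<Prod>j\<in>J. \<integral>\<^sup>+y. h j y \<partial>gamma_distribution (a j)) = (\<Prod>j\<in>?I. \<integral>\<^sup>+y. g j y \<partial>lborel) * (\<integral>\<^sup>+y. g k y \<partial>lborel)"
    using J by (simp add: prod.remove[of J k] gint mult.commute)
  also have "\<dots> = (\<integral>\<^sup>+y. (\<Prod>j\<in>?I. g j (y j)) \<partial>?L) * (\<integral>\<^sup>+u. g k u \<partial>lborel)"
    using fI g by (subst L.product_nn_integral_prod) auto
  also have "\<dots> = (\<integral>\<^sup>+y. (\<Prod>j\<in>?I. g j (y j)) * (\<integral>\<^sup>+u. g k u \<partial>lborel) \<partial>?L)"
    by (rule nn_integral_multc[symmetric]) measurable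
  also have "\<dots> = (\<integral>\<^sup>+y. \<integral>\<^sup>+t. (\<Prod>j\<in>?I. g j (y j)) * g k (t - (\<Sum>j\<in>?I. y j)) \<partial>lborel \<partial>?L)"
  proof (rule nn_integral_cong)
    fix y
    have "(\<integral>\<^sup>+u. g k u \<partial>lborel) = (\<integral>\<^sup>+t. g k (t - (\<Sum>j\<in>?I. y j)) \<partial>lborel)"
      by (subst nn_integral_real_affine[where c = 1 and t = "- (\<Sum>j\<in>?I. y j)"]) auto
    then show "(\<Prod>j\<in>?I. g j (y j)) * (\<integral>\<^sup>+u. g k u \<partial>lborel) =
      (\<integral>\<^sup>+t. (\<Prod>j\<in>?I. g j (y j)) * g k (t - (\<Sum>j\<in>?I. y j)) \<partial>lborel)"
      by (simp add: nn_integral_cmult)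
  qed
  also have "\<dots> = (\<integral>\<^sup>+t. \<integral>\<^sup>+y. (\<Prod>j\<in>?I. g j (y j)) * g k (t - (\<Sum>j\<in>?I. y j)) \<partial>?L \<partial>lborel)"
    by (rule PL.Fubini'[symmetric]) measurable
  also have "\<dots> = (\<integral>\<^sup>+t. ennreal (gamma_density ?s t) * (\<integral>\<^sup>+x. ennreal (dirichlet_density J k a x) *
        (\<Prod>j\<in>J. h j (t * (if j = k then 1 - (\<Sum>j\<in>J - {k}. x j) else x j))) \<partial>?L) \<partial>lborel)"
  proof (rule nn_integral_cong)
    fix t :: real
    show "(\<integral>\<^sup>+y. (\<Prod>j\<in>?I. g j (y j)) * g k (t - (\<Sum>j\<in>?I. y j)) \<partial>?L) =
      ennreal (gamma_density ?s t) * (\<integral>\<^sup>+x. ennreal (dirichlet_density J k a x) *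
        (\<Prod>j\<in>J. h j (t * (if j = k then 1 - (\<Sum>j\<in>J - {k}. x j) else x j))) \<partial>?L)"
    proof (cases "0 < t")
      case False
      have "(\<Prod>j\<in>?I. g j (y j)) * g k (t - (\<Sum>j\<in>?I. y j)) = 0" for y
      proof (cases "\<forall>j\<in>?I. 0 < y j")
        case True
        then have "0 \<le> (\<Sum>j\<in>?I. y j)"
          by (intro sum_nonneg) (auto simp: less_imp_le)
        then show ?thesis
          using False by (simp add: gneg)
      next
        case False
        then obtain j where "j \<in> ?I" "y j \<le> 0" by (auto simp: not_less)
        then have "(\<Prod>j\<in>?I. g j (y j)) = 0"
          using fI gneg by (intro prod_zero) auto
        then show ?thesis by simp
      qed
      then have "(\<integral>\<^sup>+y. (\<Prod>j\<in>?I. g j (y j)) * g k (t - (\<Sum>j\<in>?I. y j)) \<partial>?L) = (\<integral>\<^sup>+y. 0 \<partial>?L)"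
        by (intro nn_integral_cong) blast
      then show ?thesis
        using False by (simp add: gamma_density_def)
    next
      case True
      have rest: "t - (\<Sum>j\<in>?I. t * x j) = t * (1 - (\<Sum>j\<in>?I. x j))" for x :: "nat \<Rightarrow> real"
        by (simp add: sum_distrib_left[symmetric] algebra_simps)
      let ?H = "\<lambda>x. \<Prod>j\<in>J. h j (t * (if j = k then 1 - (\<Sum>j\<in>J - {k}. x j) else x j))"
      have [measurable]: "(\<lambda>x. h j (t * x j)) \<in> borel_measurable ?L"
        "(\<lambda>x. g j (t * x j)) \<in> borel_measurable ?L" if "j \<in> ?I" for j
        using that by measurable
      have [measurable]: "?H \<in> borel_measurable ?L"
        unfolding H by measurable
      have "(\<integral>\<^sup>+y. (\<Prod>j\<in>?I. g j (y j)) * g k (t - (\<Sum>j\<in>?I. y j)) \<partial>?L) =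
        ennreal (t ^ card ?I) * (\<integral>\<^sup>+x. (\<Prod>j\<in>?I. g j ((\<lambda>j\<in>?I. t * x j) j)) *
           g k (t - (\<Sum>j\<in>?I. (\<lambda>j\<in>?I. t * x j) j)) \<partial>?L)"
        using fI True by (subst nn_integral_PiM_lborel_scale[OF _ True]) auto
      also have "\<dots> = ennreal (t ^ card ?I) * (\<integral>\<^sup>+x. (\<Prod>j\<in>?I. g j (t * x j)) *
           g k (t * (1 - (\<Sum>j\<in>?I. x j))) \<partial>?L)"
        by (simp add: rest[symmetric] del: Diff_iff cong: prod.cong sum.cong)
      also have "\<dots> = (\<integral>\<^sup>+x. ennreal (t ^ card ?I) * ((\<Prod>j\<in>?I. g j (t * x j)) *
           g k (t * (1 - (\<Sum>j\<in>?I. x j)))) \<partial>?L)"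
        by (rule nn_integral_cmult[symmetric]) measurable
      also have "\<dots> = (\<integral>\<^sup>+x. ennreal (gamma_density ?s t) * (ennreal (dirichlet_density J k a x) * ?H x) \<partial>?L)"
      proof (rule nn_integral_cong)
        fix x :: "nat \<Rightarrow> real"
        have pos: "0 \<le> (\<Prod>j\<in>?I. gamma_density (a j) (t * x j))"
          using a by (intro prod_nonneg) (auto intro!: gamma_density_nonneg)
        have "ennreal (t ^ card ?I) * ((\<Prod>j\<in>?I. g j (t * x j)) * g k (t * (1 - (\<Sum>j\<in>?I. x j)))) =
          ennreal (t ^ card ?I) * ((\<Prod>j\<in>?I. ennreal (gamma_density (a j) (t * x j))) *
            ennreal (gamma_density (a k) (t * (1 - (\<Sum>j\<in>?I. x j))))) *
          ((\<Prod>j\<in>?I. h j (t * x j)) * h k (t * (1 - (\<Sum>j\<in>?I. x j))))"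
          by (simp add: g_def prod.distrib mult_ac)
        also have "(\<Prod>j\<in>?I. ennreal (gamma_density (a j) (t * x j))) = ennreal (\<Prod>j\<in>?I. gamma_density (a j) (t * x j))"
          using a by (intro prod_ennreal) (auto intro!: gamma_density_nonneg)
        also have "ennreal (t ^ card ?I) * (ennreal (\<Prod>j\<in>?I. gamma_density (a j) (t * x j)) *
            ennreal (gamma_density (a k) (t * (1 - (\<Sum>j\<in>?I. x j))))) =
          ennreal (t ^ card ?I * ((\<Prod>j\<in>?I. gamma_density (a j) (t * x j)) *
            gamma_density (a k) (t * (1 - (\<Sum>j\<in>?I. x j)))))"
          using True pos gamma_density_nonneg[OF a[OF J(2)]]
          by (simp only: ennreal_mult mult_nonneg_nonneg zero_le_power less_imp_le)
        also have "\<dots> = ennreal (gamma_density ?s t * dirichlet_density J k a x)"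
          using gamma_densities_polar[OF J, where a = a and t = t and x = x] a True unfolding rest by presburger
        also have "\<dots> = ennreal (gamma_density ?s t) * ennreal (dirichlet_density J k a x)"
          using gamma_density_nonneg[OF spos] by (rule ennreal_mult')
        finally show "ennreal (t ^ card ?I) * ((\<Prod>j\<in>?I. g j (t * x j)) * g k (t * (1 - (\<Sum>j\<in>?I. x j)))) =
          ennreal (gamma_density ?s t) * (ennreal (dirichlet_density J k a x) * ?H x)"
          unfolding H by (simp add: mult_ac)
      qed
      also have "\<dots> = ennreal (gamma_density ?s t) * (\<integral>\<^sup>+x. ennreal (dirichlet_density J k a x) * ?H x \<partial>?L)"
        using J by (intro nn_integral_cmult) measurable
      finally show ?thesis .
    qed
  qed
  also have "\<dots> = (\<integral>\<^sup>+t. \<integral>\<^sup>+x. ennreal (dirichlet_density J k a x) *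
        (\<Prod>j\<in>J. h j (t * (if j = k then 1 - (\<Sum>j\<in>J - {k}. x j) else x j)))
      \<partial>?L \<partial>gamma_distribution ?s)"
    unfolding gamma_distribution_eq_density[OF spos]
  proof (rule nn_integral_density[symmetric])
    have [measurable]: "(\<lambda>(t, x). h j (t * x j)) \<in> borel_measurable (lborel \<Otimes>\<^sub>M ?L)" if "j \<in> ?I" for j
      using that by measurable
    have m: "(\<lambda>(t, x). ennreal (dirichlet_density J k a x) * ((\<Prod>j\<in>?I. h j (t * x j)) * h k (t * (1 - (\<Sum>j\<in>J - {k}. x j)))))
      \<in> borel_measurable (lborel \<Otimes>\<^sub>M ?L)"
      using J by measurable
    show "(\<lambda>t. \<integral>\<^sup>+x. ennreal (dirichlet_density J k a x) *
        (\<Prod>j\<in>J. h j (t * (if j = k then 1 - (\<Sum>j\<in>J - {k}. x j) else x j))) \<partial>?L) \<in> borel_measurable lborel"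
      unfolding H using LI.borel_measurable_nn_integral[OF m] by simp
  qed auto
  finally show ?thesis .
qed

lemma prob_space_dirichlet_density:
  assumes J: "finite J" "k \<in> J" and a: "\<And>j. j \<in> J \<Longrightarrow> 0 < a j"
  shows "prob_space (density (\<Pi>\<^sub>M j\<in>J - {k}. lborel) (\<lambda>x. ennreal (dirichlet_density J k a x)))"
proof (rule prob_spaceI)
  let ?L = "\<Pi>\<^sub>M j\<in>J - {k}. (lborel :: real measure)"
  have spos: "0 < (\<Sum>j\<in>J. a j)"
    using J a by (intro sum_pos) auto
  interpret s: prob_space "gamma_distribution (\<Sum>j\<in>J. a j)"
    using spos by (intro prob_space_gamma_distribution) simp
  have [measurable]: "dirichlet_density J k a \<in> borel_measurable ?L"
    using J(1) by (rule dirichlet_density_measurable)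
  have one: "emeasure (gamma_distribution (a j)) UNIV = 1" if "j \<in> J" for j
    using prob_space.emeasure_space_1[OF prob_space_gamma_distribution, of "a j"] a[OF that] by simp
  \<comment> \<open>The polar formula for constant test functions: the total separates from the proportions.\<close>
  have "(\<integral>\<^sup>+x. ennreal (dirichlet_density J k a x) \<partial>?L) =
      (\<integral>\<^sup>+t. \<integral>\<^sup>+x. ennreal (dirichlet_density J k a x) \<partial>?L \<partial>gamma_distribution (\<Sum>j\<in>J. a j))"
    using s.emeasure_space_1 by simp
  also have "\<dots> = (\<Prod>j\<in>J. \<integral>\<^sup>+y. 1 \<partial>gamma_distribution (a j))"
    using gamma_product_polar[OF J, of a "\<lambda>_ _. 1"] a by simp
  also have "\<dots> = 1"
    using one by simp
  finally show "emeasure (density ?L (\<lambda>x. ennreal (dirichlet_density J k a x)))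
      (space (density ?L (\<lambda>x. ennreal (dirichlet_density J k a x)))) = 1"
    by (simp add: emeasure_density nn_integral_indicator' cong: nn_integral_cong)
qed

text \<open>
  A Dirichlet law records only the first \<open>n\<close> of \<open>n + 1\<close> proportions.  Giving the last one
  parameter \<open>0\<close> makes the recorded proportions sum to \<open>1\<close>, so that they
  match \<open>n\<close> independent gamma variables.  Coordinates with parameter \<open>0\<close> are constant \<open>0\<close> on both sides
  and split off as a factor that is \<open>0\<close> or \<open>1\<close>.
\<close>

lemma PiM_gamma_eq_scaled_dirichlet:
  assumes nn: "\<And>j. 0 \<le> a j" and n: "a n = 0" and pos: "0 < (\<Sum>j<n. a j)"
  shows "(\<Pi>\<^sub>M j\<in>{..<n}. gamma_distribution (a j)) =
    distr (gamma_distribution (\<Sum>j<n. a j) \<Otimes>\<^sub>M dirichlet_distribution n a) (\<Pi>\<^sub>M j\<in>{..<n}. borel)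
      (\<lambda>(t, d). \<lambda>j\<in>{..<n}. t * d j)"
    (is "_ = ?D")
proof -
  define J where "J = {j. j \<le> n \<and> 0 < a j}"
  define k where "k = Max J"
  have fJ: "finite J" by (simp add: J_def)
  have Jn: "J \<subseteq> {..<n}"
    using n by (auto simp: J_def le_less)
  have zero: "a j = 0" if "j < n" "j \<notin> J" for j
    using that nn[of j] by (auto simp: J_def)
  have sJ: "(\<Sum>j<n. a j) = (\<Sum>j\<in>J. a j)"
    using Jn zero by (intro sum.mono_neutral_right) auto
  have "J \<noteq> {}"
    using pos sJ by auto
  then have kJ: "k \<in> J"
    unfolding k_def using fJ by (intro Max_in)
  have aJ: "0 < a j" if "j \<in> J" for j
    using that by (simp add: J_def)
  let ?L = "\<Pi>\<^sub>M j\<in>J - {k}. (lborel :: real measure)"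
  let ?B = "\<Pi>\<^sub>M j\<in>{..<n}. (borel :: real measure)"
  let ?\<Psi> = "\<lambda>x. \<lambda>i\<in>{..<n}. if i \<notin> J then 0 else if i = k then 1 - (\<Sum>j\<in>J - {k}. x j) else x i"
  let ?s = "\<Sum>j<n. a j"
  have [measurable]: "dirichlet_density J k a \<in> borel_measurable ?L"
    using fJ by (rule dirichlet_density_measurable)
  have [measurable]: "(\<lambda>x. if i \<notin> J then 0 else if i = k then 1 - (\<Sum>j\<in>J - {k}. x j) else x i)
      \<in> borel_measurable ?L" for i
    by (cases "i \<in> J"; cases "i = k") (simp_all, measurable)
  have \<Psi>[measurable]: "?\<Psi> \<in> measurable ?L ?B"
    by (intro measurable_restrict) measurable
  have dir: "dirichlet_distribution n a = distr (density ?L (\<lambda>x. ennreal (dirichlet_density J k a x))) ?B ?\<Psi>"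
    unfolding dirichlet_distribution_def Let_def J_def[symmetric] k_def[symmetric] ..
  then have setsD[measurable_cong]: "sets (dirichlet_distribution n a) = sets ?B"
    by simp
  interpret dd: prob_space "density ?L (\<lambda>x. ennreal (dirichlet_density J k a x))"
    using fJ kJ aJ by (rule prob_space_dirichlet_density)
  have "prob_space (dirichlet_distribution n a)"
    unfolding dir by (intro dd.prob_space_distr) simp
  then interpret D: prob_space "dirichlet_distribution n a" .
  interpret G: product_sigma_finite "\<lambda>j. gamma_distribution (a j)"
    using prob_space_gamma_distribution[OF nn]
    by (simp add: product_sigma_finite_def prob_space_imp_sigma_finite)
  have [measurable]: "(\<lambda>(t, d). \<lambda>j\<in>{..<n}. t * d j)
      \<in> measurable (gamma_distribution ?s \<Otimes>\<^sub>M dirichlet_distribution n a) ?B"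
    unfolding split_beta' by (intro measurable_restrict) measurable
  have "?D = (\<Pi>\<^sub>M j\<in>{..<n}. gamma_distribution (a j))"
  proof (rule G.PiM_eqI)
    show "sets ?D = sets (\<Pi>\<^sub>M j\<in>{..<n}. gamma_distribution (a j))"
      by (simp, intro sets_PiM_cong) auto
  next
    fix A :: "nat \<Rightarrow> real set" assume A: "\<And>i. i \<in> {..<n} \<Longrightarrow> A i \<in> sets (gamma_distribution (a i))"
    then have A': "A i \<in> sets borel" if "i < n" for i
      using that by auto
    have box[measurable]: "Pi\<^sub>E {..<n} A \<in> sets ?B"
      using A' by (intro sets_PiM_I_finite) auto
    let ?h = "\<lambda>j y. indicator (A j) y :: ennreal"
    have [measurable]: "?h j \<in> borel_measurable borel" if "j \<in> {..<n}" for j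
      using A' that by simp
    have hJ: "?h j \<in> borel_measurable borel" if "j \<in> J" for j
      using A'[of j] Jn that by auto
    have "emeasure ?D (Pi\<^sub>E {..<n} A) = (\<integral>\<^sup>+x. indicator (Pi\<^sub>E {..<n} A) x \<partial>?D)"
      by simp
    also have "\<dots> = (\<integral>\<^sup>+p. indicator (Pi\<^sub>E {..<n} A) ((\<lambda>(t, d). \<lambda>j\<in>{..<n}. t * d j) p)
        \<partial>(gamma_distribution ?s \<Otimes>\<^sub>M dirichlet_distribution n a))"
      by (rule nn_integral_distr) measurable
    also have "\<dots> = (\<integral>\<^sup>+p. (\<Prod>j<n. ?h j (fst p * snd p j))
        \<partial>(gamma_distribution ?s \<Otimes>\<^sub>M dirichlet_distribution n a))"
      by (intro nn_integral_cong)
         (auto simp: indicator_def split_beta' PiE_iff prod_zero_iff extensional_def)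
    also have "\<dots> = (\<integral>\<^sup>+t. \<integral>\<^sup>+d. (\<Prod>j<n. ?h j (t * d j)) \<partial>dirichlet_distribution n a \<partial>gamma_distribution ?s)"
      by (subst D.nn_integral_fst[symmetric]) auto
    also have "\<dots> = (\<integral>\<^sup>+t. (\<Prod>j\<in>{..<n} - J. ?h j 0) *
        (\<integral>\<^sup>+x. ennreal (dirichlet_density J k a x) *
          (\<Prod>j\<in>J. ?h j (t * (if j = k then 1 - (\<Sum>j\<in>J - {k}. x j) else x j))) \<partial>?L) \<partial>gamma_distribution ?s)"
    proof (rule nn_integral_cong)
      fix t :: real
      have split: "(\<Prod>j<n. ?h j (t * ?\<Psi> x j)) = (\<Prod>j\<in>{..<n} - J. ?h j 0) *
          (\<Prod>j\<in>J. ?h j (t * (if j = k then 1 - (\<Sum>j\<in>J - {k}. x j) else x j)))" for x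
      proof -
        have "(\<Prod>j<n. ?h j (t * ?\<Psi> x j)) = (\<Prod>j\<in>{..<n} - J. ?h j (t * ?\<Psi> x j)) * (\<Prod>j\<in>J. ?h j (t * ?\<Psi> x j))"
          using Jn by (intro prod.subset_diff) auto
        also have "(\<Prod>j\<in>{..<n} - J. ?h j (t * ?\<Psi> x j)) = (\<Prod>j\<in>{..<n} - J. ?h j 0)"
          by (intro prod.cong) auto
        also have "(\<Prod>j\<in>J. ?h j (t * ?\<Psi> x j)) = (\<Prod>j\<in>J. ?h j (t * (if j = k then 1 - (\<Sum>j\<in>J - {k}. x j) else x j)))"
          using Jn by (intro prod.cong) auto
        finally show ?thesis .
      qed
      have m1: "(\<lambda>d. \<Prod>j<n. ?h j (t * d j)) \<in> borel_measurable ?B"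
        by measurable
      have m2: "(\<lambda>x. \<Prod>j<n. ?h j (t * ?\<Psi> x j)) \<in> borel_measurable ?L"
        using measurable_compose[OF \<Psi> m1] .
      have m3: "(\<lambda>x. \<Prod>j\<in>J. ?h j (t * (if j = k then 1 - (\<Sum>j\<in>J - {k}. x j) else x j))) \<in> borel_measurable ?L"
      proof (intro borel_measurable_prod_ennreal)
        fix j assume "j \<in> J"
        then show "(\<lambda>x. ?h j (t * (if j = k then 1 - (\<Sum>j\<in>J - {k}. x j) else x j))) \<in> borel_measurable ?L"
          using hJ[of j]
          by (cases "j = k") (auto intro!: measurable_compose[of "\<lambda>x. t * _ x" _ borel])
      qed
      have "(\<integral>\<^sup>+d. (\<Prod>j<n. ?h j (t * d j)) \<partial>dirichlet_distribution n a) =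
        (\<integral>\<^sup>+x. ennreal (dirichlet_density J k a x) * (\<Prod>j<n. ?h j (t * ?\<Psi> x j)) \<partial>?L)"
        unfolding dir using m1 m2 by (subst nn_integral_distr) (auto intro!: nn_integral_density)
      also have "\<dots> = (\<integral>\<^sup>+x. (\<Prod>j\<in>{..<n} - J. ?h j 0) * (ennreal (dirichlet_density J k a x) *
          (\<Prod>j\<in>J. ?h j (t * (if j = k then 1 - (\<Sum>j\<in>J - {k}. x j) else x j)))) \<partial>?L)"
        unfolding split by (simp only: mult_ac)
      also have "\<dots> = (\<Prod>j\<in>{..<n} - J. ?h j 0) *
        (\<integral>\<^sup>+x. ennreal (dirichlet_density J k a x) *
          (\<Prod>j\<in>J. ?h j (t * (if j = k then 1 - (\<Sum>j\<in>J - {k}. x j) else x j))) \<partial>?L)"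
        by (rule nn_integral_cmult, rule borel_measurable_times_ennreal[OF _ m3]) measurable
      finally show "(\<integral>\<^sup>+d. (\<Prod>j<n. ?h j (t * d j)) \<partial>dirichlet_distribution n a) =
        (\<Prod>j\<in>{..<n} - J. ?h j 0) *
        (\<integral>\<^sup>+x. ennreal (dirichlet_density J k a x) *
          (\<Prod>j\<in>J. ?h j (t * (if j = k then 1 - (\<Sum>j\<in>J - {k}. x j) else x j))) \<partial>?L)" .
    qed
    also have "\<dots> = (\<Prod>j\<in>{..<n} - J. ?h j 0) *
        (\<integral>\<^sup>+t. (\<integral>\<^sup>+x. ennreal (dirichlet_density J k a x) *
          (\<Prod>j\<in>J. ?h j (t * (if j = k then 1 - (\<Sum>j\<in>J - {k}. x j) else x j))) \<partial>?L) \<partial>gamma_distribution ?s)"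
    proof -
      have "(\<Prod>j\<in>{..<n} - J. ?h j 0) = 0 \<or> (\<Prod>j\<in>{..<n} - J. ?h j 0) = 1"
      proof (cases "\<forall>j\<in>{..<n} - J. 0 \<in> A j")
        case True
        then show ?thesis by simp
      next
        case False
        then obtain j where "j \<in> {..<n} - J" "?h j 0 = 0" by auto
        then show ?thesis by (intro disjI1 prod_zero) blast+
      qed
      then show ?thesis
        by (elim disjE) (simp_all only: mult_zero_left mult_1 nn_integral_const)
    qed
    also have "\<dots> = (\<Prod>j\<in>{..<n} - J. ?h j 0) * (\<Prod>j\<in>J. \<integral>\<^sup>+y. ?h j y \<partial>gamma_distribution (a j))"
      unfolding sJ using gamma_product_polar[OF fJ kJ aJ hJ] by simp
    also have "(\<Prod>j\<in>{..<n} - J. ?h j 0) = (\<Prod>j\<in>{..<n} - J. emeasure (gamma_distribution (a j)) (A j))"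
      using zero A' by (intro prod.cong) (auto simp: gamma_distribution_0)
    also have "(\<Prod>j\<in>J. \<integral>\<^sup>+y. ?h j y \<partial>gamma_distribution (a j)) = (\<Prod>j\<in>J. emeasure (gamma_distribution (a j)) (A j))"
      using Jn A' by (intro prod.cong) auto
    also have "(\<Prod>j\<in>{..<n} - J. emeasure (gamma_distribution (a j)) (A j)) *
        (\<Prod>j\<in>J. emeasure (gamma_distribution (a j)) (A j)) =
      (\<Prod>j<n. emeasure (gamma_distribution (a j)) (A j))"
      using Jn by (intro prod.subset_diff[symmetric]) auto
    finally show "emeasure ?D (Pi\<^sub>E {..<n} A) = (\<Prod>j<n. emeasure (gamma_distribution (a j)) (A j))" .
  qed simp
  then show "(\<Pi>\<^sub>M j\<in>{..<n}. gamma_distribution (a j)) = ?D" ..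
qed

lemma prob_algebra_random_finite_measure:
  assumes \<phi>: "\<phi> \<in> measurable Q (prob_algebra borel)"
  shows "random_finite_measure Q \<phi>"
proof -
  have sp: "prob_space (\<phi> v) \<and> sets (\<phi> v) = sets borel" if "v \<in> space Q" for v
    using measurable_space[OF \<phi> that] by (simp add: space_prob_algebra)
  have "(\<lambda>v. measure (\<phi> v) B) \<in> borel_measurable Q" if "B \<in> sets borel" for B
    using measurable_compose[OF measurable_prob_algebraD[OF \<phi>] measurable_measure_subprob_algebra[OF that]] .
  then show "random_finite_measure Q \<phi>"
    using sp by (auto simp: random_finite_measure_def prob_space_def)
qed

text \<open>
  The identity \<open>\<gamma>(f) \<sim> T * \<phi>(f)\<close> for simple \<open>f\<close>: both sides are the same linear combination of
  the masses of the cells on which \<open>f\<close> is constant.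
\<close>

lemma gamma_law_simple_function:
  fixes f :: "real \<Rightarrow> real"
  assumes \<alpha>: "finite_measure \<alpha>" "sets \<alpha> = sets borel" "0 < measure \<alpha> UNIV"
    and gp: "gamma_process \<alpha> P \<gamma>" and dp: "dirichlet_process \<alpha> Q \<phi>"
    and f: "simple_function borel f"
  shows "distr P borel (\<lambda>\<omega>. LINT x|\<gamma> \<omega>. f x) =
    distr (gamma_distribution (measure \<alpha> UNIV) \<Otimes>\<^sub>M Q) borel (\<lambda>(t, v). t * (LINT x|\<phi> v. f x))"
proof -
  interpret P: prob_space P using gp by (simp add: gamma_process_def)
  interpret Q: prob_space Q using dp by (simp add: dirichlet_process_def)
  interpret \<alpha>: finite_measure \<alpha> by fact
  have rP: "random_finite_measure P \<gamma>" using gp by (simp add: gamma_process_def)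
  have rQ: "random_finite_measure Q \<phi>"
    using dp by (auto simp: dirichlet_process_def intro: prob_algebra_random_finite_measure)
  obtain k C0 c d where C0: "measurable_partition k C0"
    and c0: "\<And>j x. j < k \<Longrightarrow> x \<in> C0 j \<Longrightarrow> f x = c j \<and> f x = d j"
    using simple_functions_partition[OF f f] by metis
  \<comment> \<open>The additional empty cell serves as the last one, which the Dirichlet law leaves out.\<close>
  define C where "C j = (if j < k then C0 j else {})" for j
  have C: "measurable_partition k C"
    using C0 by (auto simp: measurable_partition_def disjoint_family_on_def C_def)
  have CS: "measurable_partition (Suc k) C"
  proof -
    have Ck: "C k = {}" by (simp add: C_def)
    show ?thesis
      using C unfolding measurable_partition_def
      by (auto simp: Ck lessThan_Suc less_Suc_eq disjoint_family_on_def)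
  qed
  have c: "f x = c j" if "j < k" "x \<in> C j" for j x
    using c0 that by (auto simp: C_def)
  have Cm: "C j \<in> sets borel" for j
    using C by (auto simp: measurable_partition_def C_def)
  define a where "a j = measure \<alpha> (C j)" for j
  have nn: "0 \<le> a j" for j by (simp add: a_def)
  have ak: "a k = 0" by (simp add: a_def C_def)
  have suma: "(\<Sum>j<k. a j) = measure \<alpha> UNIV"
  proof -
    have "(\<Sum>j<k. a j) = measure \<alpha> (\<Union>j<k. C j)"
      unfolding a_def using C Cm \<alpha>(2)
      by (intro \<alpha>.finite_measure_finite_Union[symmetric]) (auto simp: measurable_partition_def)
    then show ?thesis
      using C by (simp add: measurable_partition_def)
  qed
  have k0: "k \<noteq> 0"
    using suma \<alpha>(3) by (cases k) auto
  let ?B = "\<Pi>\<^sub>M j\<in>{..<k}. (borel :: real measure)"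
  let ?X = "\<lambda>\<omega>. \<lambda>j\<in>{..<k}. measure (\<gamma> \<omega>) (C j)"
  let ?Y = "\<lambda>v. \<lambda>j\<in>{..<k}. measure (\<phi> v) (C j)"
  have [measurable]: "(\<lambda>\<omega>. measure (\<gamma> \<omega>) (C j)) \<in> borel_measurable P"
    "(\<lambda>v. measure (\<phi> v) (C j)) \<in> borel_measurable Q" for j
    using rP rQ Cm by (auto simp: random_finite_measure_def)
  have X[measurable]: "?X \<in> measurable P ?B" and Y[measurable]: "?Y \<in> measurable Q ?B"
    by (intro measurable_restrict; measurable)+
  have DY: "distr Q ?B ?Y = dirichlet_distribution k a"
    using dp CS unfolding dirichlet_process_def a_def by blast
  have "distr P ?B ?X = (\<Pi>\<^sub>M j\<in>{..<k}. distr P borel (\<lambda>\<omega>. measure (\<gamma> \<omega>) (C j)))"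
    using gp C k0 unfolding gamma_process_def
    by (subst P.indep_vars_iff_distr_eq_PiM[symmetric]) auto
  also have "\<dots> = (\<Pi>\<^sub>M j\<in>{..<k}. gamma_distribution (a j))"
    using gp C unfolding gamma_process_def a_def by (intro PiM_cong) auto
  also have "\<dots> = distr (gamma_distribution (measure \<alpha> UNIV) \<Otimes>\<^sub>M distr Q ?B ?Y) ?B (\<lambda>(t, d). \<lambda>j\<in>{..<k}. t * d j)"
    using PiM_gamma_eq_scaled_dirichlet[of a k, OF nn ak] \<alpha>(3) unfolding suma DY by simp
  also have "gamma_distribution (measure \<alpha> UNIV) \<Otimes>\<^sub>M distr Q ?B ?Y =
      distr (gamma_distribution (measure \<alpha> UNIV) \<Otimes>\<^sub>M Q) (borel \<Otimes>\<^sub>M ?B) (\<lambda>(t, v). (t, ?Y v))"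
  proof -
    have "sigma_finite_measure (distr Q ?B ?Y)"
      using Q.prob_space_distr[OF Y] by (rule prob_space_imp_sigma_finite)
    then have "distr (gamma_distribution (measure \<alpha> UNIV)) borel (\<lambda>t. t) \<Otimes>\<^sub>M distr Q ?B ?Y =
      distr (gamma_distribution (measure \<alpha> UNIV) \<Otimes>\<^sub>M Q) (borel \<Otimes>\<^sub>M ?B) (\<lambda>(t, v). (t, ?Y v))"
      by (intro pair_measure_distr) auto
    then show ?thesis
      by (simp add: distr_id2)
  qed
  finally have eq: "distr P ?B ?X =
    distr (distr (gamma_distribution (measure \<alpha> UNIV) \<Otimes>\<^sub>M Q) (borel \<Otimes>\<^sub>M ?B) (\<lambda>(t, v). (t, ?Y v)))
      ?B (\<lambda>(t, d). \<lambda>j\<in>{..<k}. t * d j)" .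
  let ?S = "\<lambda>x. \<Sum>j<k. c j * x j"
  have [measurable]: "?S \<in> borel_measurable ?B" by measurable
  have [measurable]: "(\<lambda>(t, d). \<lambda>j\<in>{..<k}. t * d j :: real) \<in> measurable (borel \<Otimes>\<^sub>M ?B) ?B"
    unfolding split_beta' by (intro measurable_restrict) measurable
  have "distr P borel (\<lambda>\<omega>. LINT x|\<gamma> \<omega>. f x) = distr P borel (\<lambda>\<omega>. ?S (?X \<omega>))"
    using rP by (intro distr_cong) (auto simp: random_finite_measure_def integral_on_partition(2)[OF _ _ C c])
  also have "\<dots> = distr (distr P ?B ?X) borel ?S"
    by (simp add: distr_distr o_def)
  also have "\<dots> = distr (gamma_distribution (measure \<alpha> UNIV) \<Otimes>\<^sub>M Q) borel
      (\<lambda>p. ?S (\<lambda>j\<in>{..<k}. fst p * ?Y (snd p) j))"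
    unfolding eq by (simp add: distr_distr o_def split_beta')
  also have "\<dots> = distr (gamma_distribution (measure \<alpha> UNIV) \<Otimes>\<^sub>M Q) borel (\<lambda>(t, v). t * (LINT x|\<phi> v. f x))"
    using rQ
    by (intro distr_cong)
       (auto simp: space_pair_measure random_finite_measure_def integral_on_partition(2)[OF _ _ C c]
          sum_distrib_left mult_ac intro!: sum.cong)
  finally show ?thesis .
qed

section \<open>Quasi-invariance and Laplace transform of the gamma process\<close>

lemma integral_gamma_distribution_tilt:
  assumes "0 \<le> s" and r: "0 \<le> r"
  shows "(CLINT x|gamma_distribution s. iexp (c * x) * of_real (exp (- r * x))) =
    of_real ((1 + r) powr (- s)) * (CLINT x|gamma_distribution s. iexp (c / (1 + r) * x))"
proof -
  have p: "(1 + r) powr (- s) * (1 + r) powr s = 1"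
    using r by (simp add: powr_add[symmetric])
  have "(CLINT x|gamma_distribution s. iexp (c / (1 + r) * x)) =
      (CLINT x|distr (gamma_distribution s) borel (\<lambda>x. x / (1 + r)). iexp (c * x))"
    by (simp add: integral_distr)
  also have "\<dots> = (CLINT x|gamma_distribution s. ((1 + r) powr s * exp (- r * x)) *\<^sub>R iexp (c * x))"
    unfolding distr_gamma_distribution_scale[OF assms] by (rule integral_density) auto
  also have "\<dots> = (CLINT x|gamma_distribution s. of_real ((1 + r) powr s) * (iexp (c * x) * of_real (exp (- r * x))))"
    by (simp add: scaleR_conv_of_real mult_ac)
  also have "\<dots> = of_real ((1 + r) powr s) * (CLINT x|gamma_distribution s. iexp (c * x) * of_real (exp (- r * x)))"
    by (rule integral_mult_right_zero)
  finally show ?thesis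
    using p by (simp add: mult.assoc[symmetric] flip: of_real_mult)
qed

text \<open>
  On a common partition both expectations factor into one integral per cell, where the tilting
  identity for the gamma distribution applies.  The characteristic function on the right, for \<open>f / (1 + r)\<close>
  in place of \<open>f\<close>, is that of the process divided by \<open>1 + r\<close>.
\<close>

lemma gamma_process_quasi_invariance_simple:
  fixes f r :: "real \<Rightarrow> real"
  assumes \<alpha>: "finite_measure \<alpha>" "sets \<alpha> = sets borel"
    and gp: "gamma_process \<alpha> P \<gamma>"
    and f: "simple_function borel f" and r: "simple_function borel r" "\<And>x. 0 \<le> r x"
  shows "(CLINT \<omega>|P. iexp (LINT x|\<gamma> \<omega>. f x) * of_real (exp (- (LINT x|\<gamma> \<omega>. r x)))) =
    of_real (exp (- (LINT x|\<alpha>. ln (1 + r x)))) * (CLINT \<omega>|P. iexp (LINT x|\<gamma> \<omega>. f x / (1 + r x)))"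
proof -
  interpret P: prob_space P using gp by (simp add: gamma_process_def)
  have rP: "finite_measure (\<gamma> \<omega>)" "sets (\<gamma> \<omega>) = sets borel" if "\<omega> \<in> space P" for \<omega>
    using gp that by (auto simp: gamma_process_def random_finite_measure_def)
  obtain k C c d where C: "measurable_partition k C"
    and cd: "\<And>j x. j < k \<Longrightarrow> x \<in> C j \<Longrightarrow> f x = c j \<and> r x = d j"
    and ne: "\<And>j. j < k \<Longrightarrow> C j \<noteq> {}"
    using simple_functions_partition[OF f r(1)] by metis
  have d0: "0 \<le> d j" if "j < k" for j
    using ne[OF that] cd[OF that] r(2) by (metis ex_in_conv)
  define X where "X j \<omega> = measure (\<gamma> \<omega>) (C j)" for j \<omega>
  define a where "a j = measure \<alpha> (C j)" for j
  have X0: "0 \<le> X j \<omega>" for j \<omega>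
    by (simp add: X_def)
  have indep: "P.indep_vars (\<lambda>_. borel) X {..<k}"
    and XD: "j < k \<Longrightarrow> distr P borel (X j) = gamma_distribution (a j)" for j
    using gp C by (auto simp: gamma_process_def X_def[abs_def] a_def)
  have Xm[measurable]: "X j \<in> borel_measurable P" if "j < k" for j
    using indep that by (auto simp: P.indep_vars_def)
  have prodE: "(CLINT \<omega>|P. (\<Prod>j<k. H j (X j \<omega>))) = (\<Prod>j<k. CLINT x|gamma_distribution (a j). H j x)"
    if H: "\<And>j. j < k \<Longrightarrow> H j \<in> borel_measurable borel" and b: "\<And>j x. j < k \<Longrightarrow> 0 \<le> x \<Longrightarrow> norm (H j x) \<le> 1"
    for H :: "nat \<Rightarrow> real \<Rightarrow> complex"
  proof -
    have "(CLINT \<omega>|P. (\<Prod>j<k. H j (X j \<omega>))) = (\<Prod>j<k. CLINT \<omega>|P. H j (X j \<omega>))"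
    proof (rule P.indep_vars_lebesgue_integral)
      show "P.indep_vars (\<lambda>_. borel) (\<lambda>j \<omega>. H j (X j \<omega>)) {..<k}"
        by (rule P.indep_vars_compose2[OF indep]) (use H in auto)
      show "integrable P (\<lambda>\<omega>. H j (X j \<omega>))" if "j \<in> {..<k}" for j
        using that H b X0
        by (intro P.integrable_const_bound[where B = 1] AE_I2 measurable_compose[OF Xm]) auto
    qed simp
    also have "\<dots> = (\<Prod>j<k. CLINT x|gamma_distribution (a j). H j x)"
    proof (rule prod.cong)
      fix j assume "j \<in> {..<k}"
      then have j: "j < k" by simp
      show "(CLINT \<omega>|P. H j (X j \<omega>)) = (CLINT x|gamma_distribution (a j). H j x)"
        unfolding XD[OF j, symmetric] using H[OF j] Xm[OF j] by (simp add: integral_distr)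
    qed simp
    finally show ?thesis .
  qed
  have ifr: "(LINT x|\<gamma> \<omega>. f x) = (\<Sum>j<k. c j * X j \<omega>)" "(LINT x|\<gamma> \<omega>. r x) = (\<Sum>j<k. d j * X j \<omega>)"
    "(LINT x|\<gamma> \<omega>. f x / (1 + r x)) = (\<Sum>j<k. c j / (1 + d j) * X j \<omega>)" if "\<omega> \<in> space P" for \<omega>
    unfolding X_def using rP[OF that] C cd by (intro integral_on_partition(2); simp)+
  have "(CLINT \<omega>|P. iexp (LINT x|\<gamma> \<omega>. f x) * of_real (exp (- (LINT x|\<gamma> \<omega>. r x)))) =
      (CLINT \<omega>|P. (\<Prod>j<k. iexp (c j * X j \<omega>) * of_real (exp (- d j * X j \<omega>))))"
  proof (rule Bochner_Integration.integral_cong)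
    fix \<omega> assume "\<omega> \<in> space P"
    then show "iexp (LINT x|\<gamma> \<omega>. f x) * of_real (exp (- (LINT x|\<gamma> \<omega>. r x))) =
      (\<Prod>j<k. iexp (c j * X j \<omega>) * of_real (exp (- d j * X j \<omega>)))"
      by (simp add: ifr prod.distrib exp_sum sum_distrib_left flip: sum_negf of_real_prod)
  qed simp
  also have "\<dots> = (\<Prod>j<k. CLINT x|gamma_distribution (a j). iexp (c j * x) * of_real (exp (- d j * x)))"
  proof (rule prodE)
    show "norm (iexp (c j * x) * of_real (exp (- d j * x))) \<le> 1" if "j < k" "0 \<le> x" for j x
      using d0[OF that(1)] that(2) by (simp add: norm_mult)
  qed auto
  also have "\<dots> = (\<Prod>j<k. of_real ((1 + d j) powr (- a j)) *
      (CLINT x|gamma_distribution (a j). iexp (c j / (1 + d j) * x)))"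
    using d0 by (intro prod.cong refl integral_gamma_distribution_tilt) (auto simp: a_def)
  also have "\<dots> = of_real (\<Prod>j<k. (1 + d j) powr (- a j)) *
      (\<Prod>j<k. CLINT x|gamma_distribution (a j). iexp (c j / (1 + d j) * x))"
    by (simp add: prod.distrib)
  also have "(\<Prod>j<k. CLINT x|gamma_distribution (a j). iexp (c j / (1 + d j) * x)) =
      (CLINT \<omega>|P. (\<Prod>j<k. iexp (c j / (1 + d j) * X j \<omega>)))"
    by (rule prodE[symmetric]) auto
  also have "\<dots> = (CLINT \<omega>|P. iexp (LINT x|\<gamma> \<omega>. f x / (1 + r x)))"
    by (intro Bochner_Integration.integral_cong refl) (simp add: ifr exp_sum sum_distrib_left)
  also have "(\<Prod>j<k. (1 + d j) powr (- a j)) = exp (- (LINT x|\<alpha>. ln (1 + r x)))"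
  proof -
    have "(LINT x|\<alpha>. ln (1 + r x)) = (\<Sum>j<k. ln (1 + d j) * a j)"
      unfolding a_def using \<alpha> C cd by (intro integral_on_partition(2)) auto
    moreover have "(1 + d j) powr (- a j) = exp (- (ln (1 + d j) * a j))" if "j < k" for j
      using d0[OF that] by (simp add: powr_def)
    ultimately show ?thesis
      by (simp add: exp_sum flip: sum_negf)
  qed
  finally show ?thesis .
qed

lemma gamma_process_laplace_simple:
  fixes r :: "real \<Rightarrow> real"
  assumes \<alpha>: "finite_measure \<alpha>" "sets \<alpha> = sets borel"
    and gp: "gamma_process \<alpha> P \<gamma>"
    and r: "simple_function borel r" "\<And>x. 0 \<le> r x"
  shows "(LINT \<omega>|P. exp (- (LINT x|\<gamma> \<omega>. r x))) = exp (- (LINT x|\<alpha>. ln (1 + r x)))"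
proof -
  interpret P: prob_space P using gp by (simp add: gamma_process_def)
  have "complex_of_real (LINT \<omega>|P. exp (- (LINT x|\<gamma> \<omega>. r x))) = of_real (exp (- (LINT x|\<alpha>. ln (1 + r x))))"
    using gamma_process_quasi_invariance_simple[OF \<alpha> gp _ r, of "\<lambda>_. 0"] P.prob_space
    by simp
  then show ?thesis
    by (simp only: of_real_eq_iff)
qed

section \<open>Almost sure integrability of the identity\<close>

text \<open>
  If the Laplace transforms at \<open>l m\<close> are at least \<open>c m\<close> along the whole sequence, the event of divergence
  to infinity contributes nothing in the limit, so its complement has probability at least
  \<open>c m\<close>.
\<close>

lemma AE_not_diverging:
  fixes X :: "nat \<Rightarrow> 'a \<Rightarrow> real"
  assumes M: "prob_space M" and X[measurable]: "\<And>n. X n \<in> borel_measurable M"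
    and X0: "\<And>n \<omega>. \<omega> \<in> space M \<Longrightarrow> 0 \<le> X n \<omega>"
    and E[measurable]: "Measurable.pred M E"
    and div: "\<And>\<omega>. \<omega> \<in> space M \<Longrightarrow> E \<omega> \<Longrightarrow> filterlim (\<lambda>n. X n \<omega>) at_top sequentially"
    and l: "\<And>m. 0 < l m" and lower: "\<And>m n. c m \<le> (LINT \<omega>|M. exp (- l m * X n \<omega>))"
    and c: "c \<longlonglongrightarrow> (1::real)"
  shows "AE \<omega> in M. \<not> E \<omega>"
proof -
  interpret prob_space M by fact
  let ?N = "{\<omega>\<in>space M. \<not> E \<omega>}" and ?E = "{\<omega>\<in>space M. E \<omega>}"
  have "c m \<le> prob ?N" for m
  proof -
    have int: "integrable M (\<lambda>\<omega>. indicator ?E \<omega> * exp (- l m * X n \<omega>))" for n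
      using X0 l[of m] by (intro integrable_const_bound[where B = 1] AE_I2) (auto simp: indicator_def)
    have "c m \<le> prob ?N + (LINT \<omega>|M. indicator ?E \<omega> * exp (- l m * X n \<omega>))" for n
    proof -
      have "(LINT \<omega>|M. exp (- l m * X n \<omega>)) \<le> (LINT \<omega>|M. indicator ?N \<omega> + indicator ?E \<omega> * exp (- l m * X n \<omega>))"
      proof (rule integral_mono)
        show "integrable M (\<lambda>\<omega>. exp (- l m * X n \<omega>))"
          using X0 l[of m] by (intro integrable_const_bound[where B = 1] AE_I2) auto
        show "integrable M (\<lambda>\<omega>. indicator ?N \<omega> + indicator ?E \<omega> * exp (- l m * X n \<omega>))"
          by (intro Bochner_Integration.integrable_add int) (auto simp: emeasure_eq_measure)
      qed (use X0 l[of m] in \<open>auto simp: indicator_def\<close>)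
      also have "\<dots> = prob ?N + (LINT \<omega>|M. indicator ?E \<omega> * exp (- l m * X n \<omega>))"
        by (subst Bochner_Integration.integral_add[OF _ int]) (auto simp: emeasure_eq_measure Int_def cong: conj_cong)
      finally show ?thesis
        using lower[of m n] by simp
    qed
    moreover have "(\<lambda>n. prob ?N + (LINT \<omega>|M. indicator ?E \<omega> * exp (- l m * X n \<omega>))) \<longlonglongrightarrow> prob ?N + (LINT \<omega>|M. 0)"
    proof (intro tendsto_add tendsto_const integral_dominated_convergence[where w = "\<lambda>_. 1"] AE_I2)
      fix \<omega> assume \<omega>: "\<omega> \<in> space M"
      show "(\<lambda>n. indicator ?E \<omega> * exp (- l m * X n \<omega>)) \<longlonglongrightarrow> 0"
      proof (cases "E \<omega>")
        case True
        have "filterlim (\<lambda>n. l m * X n \<omega>) at_top sequentially"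
          using filterlim_tendsto_pos_mult_at_top[OF tendsto_const l[of m] div[OF \<omega> True]] .
        then have "(\<lambda>n. exp (- (l m * X n \<omega>))) \<longlonglongrightarrow> 0"
          by (intro filterlim_compose[OF exp_at_bot] filterlim_compose[OF filterlim_uminus_at_bot_at_top])
        then show ?thesis
          using True \<omega> by simp
      qed simp
      show "norm (indicator ?E \<omega> * exp (- l m * X n \<omega>)) \<le> 1" for n
        using X0[OF \<omega>] l[of m] by (auto simp: indicator_def)
    qed auto
    ultimately show ?thesis
      by (intro LIMSEQ_le_const[of _ "prob ?N"]) auto
  qed
  then have "1 \<le> prob ?N"
    using c by (intro LIMSEQ_le_const2) auto
  then have "prob ?N = 1"
    using prob_le_1[of ?N] by simp
  then show ?thesis
    by (simp add: prob_Collect_eq_1)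
qed

lemma integral_abs_diverges:
  assumes M: "finite_measure M" "sets M = sets borel"
    and F: "\<And>n. simple_function borel (F n)" "\<And>x. (\<lambda>n. F n x) \<longlonglongrightarrow> x"
    and ni: "\<not> integrable M (\<lambda>x. x :: real)"
  shows "filterlim (\<lambda>n. LINT x|M. \<bar>F n x\<bar>) at_top sequentially"
proof -
  note M(2)[measurable_cong]
  have Fm[measurable]: "F n \<in> borel_measurable borel" for n
    using F(1) by (rule borel_measurable_simple_function)
  have intF: "integrable M (\<lambda>x. \<bar>F n x\<bar>)" for n
  proof -
    obtain k C c d where "measurable_partition k C" "\<And>j x. j < k \<Longrightarrow> x \<in> C j \<Longrightarrow> F n x = c j \<and> F n x = d j"
      using simple_functions_partition[OF F(1) F(1), of n n] by metis
    then have "integrable M (F n)"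
      using M by (intro integral_on_partition(1)[of M k C _ c]) auto
    then show ?thesis by simp
  qed
  have "(\<integral>\<^sup>+x. ennreal \<bar>x\<bar> \<partial>M) = \<infinity>"
    using ni by (auto simp: integrable_iff_bounded less_top[symmetric])
  moreover have "(\<integral>\<^sup>+x. ennreal \<bar>x\<bar> \<partial>M) = (\<integral>\<^sup>+x. liminf (\<lambda>n. ennreal \<bar>F n x\<bar>) \<partial>M)"
    using F(2)
    by (intro nn_integral_cong lim_imp_Liminf[symmetric] tendsto_ennrealI tendsto_rabs) auto
  moreover have "\<dots> \<le> liminf (\<lambda>n. \<integral>\<^sup>+x. ennreal \<bar>F n x\<bar> \<partial>M)"
    by (intro nn_integral_liminf) auto
  ultimately have inf: "liminf (\<lambda>n. ennreal (LINT x|M. \<bar>F n x\<bar>)) = \<infinity>"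
    using intF by (simp add: nn_integral_eq_integral top_unique)
  show ?thesis
    unfolding filterlim_at_top
  proof
    fix Z :: real
    have "ennreal Z < liminf (\<lambda>n. ennreal (LINT x|M. \<bar>F n x\<bar>))"
      by (simp add: inf)
    then have "\<forall>\<^sub>F n in sequentially. ennreal Z < ennreal (LINT x|M. \<bar>F n x\<bar>)"
      by (rule less_LiminfD)
    then show "\<forall>\<^sub>F n in sequentially. Z \<le> (LINT x|M. \<bar>F n x\<bar>)"
      by eventually_elim (meson ennreal_leI linorder_not_less linorder_linear)
  qed
qed

lemma identity_approximation:
  obtains F :: "nat \<Rightarrow> real \<Rightarrow> real" where "\<And>n. simple_function borel (F n)"
    "\<And>x. (\<lambda>n. F n x) \<longlonglongrightarrow> x" "\<And>n x. \<bar>F n x\<bar> \<le> 2 * \<bar>x\<bar>"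
  using borel_measurable_implies_sequence_metric[of "\<lambda>x::real. x" borel 0]
  by (auto simp: dist_real_def)

lemma log_integrable_measuresD:
  assumes "\<alpha> \<in> log_integrable_measures a"
  shows "finite_measure \<alpha>" "sets \<alpha> = sets borel" "measure \<alpha> UNIV = a" "integrable \<alpha> (\<lambda>x. ln (1 + \<bar>x\<bar>))"
  using assms by (auto simp: log_integrable_measures_def)

text \<open>
  The factor \<open>1/2\<close> in the Laplace argument absorbs the factor \<open>2\<close> in the bound on the approximating simple
  functions; dominated convergence uses exactly the logarithmic integrability of \<open>\<alpha>\<close>.
\<close>

lemma gamma_process_laplace_lower_bound:
  assumes \<alpha>: "\<alpha> \<in> log_integrable_measures a" and gp: "gamma_process \<alpha> P \<gamma>"
    and F: "\<And>n. simple_function borel (F n)" "\<And>n x. \<bar>F n x\<bar> \<le> 2 * \<bar>x\<bar>"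
  defines "c \<equiv> \<lambda>m. exp (- (LINT x|\<alpha>. ln (1 + \<bar>x\<bar> / real (Suc m))))"
  shows "c m \<le> (LINT \<omega>|P. exp (- (1 / (2 * real (Suc m))) * (LINT x|\<gamma> \<omega>. \<bar>F n x\<bar>)))"
    and "c \<longlonglongrightarrow> 1"
proof -
  note \<alpha>D = log_integrable_measuresD[OF \<alpha>]
  note \<alpha>D(2)[measurable_cong]
  have [measurable]: "F n \<in> borel_measurable borel" for n
    using F(1) by (rule borel_measurable_simple_function)
  have bound: "ln (1 + \<bar>x\<bar> / real (Suc m)) \<le> ln (1 + \<bar>x\<bar>)" for m and x :: real
    by (auto simp: field_simps intro!: add_pos_nonneg mult_left_mono)
  have int: "integrable \<alpha> (\<lambda>x. ln (1 + \<bar>x\<bar> / real (Suc m)))" for m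
    using bound by (intro Bochner_Integration.integrable_bound[OF \<alpha>D(4)]) auto
  let ?l = "1 / (2 * real (Suc m))"
  have le: "?l * \<bar>F n x\<bar> \<le> \<bar>x\<bar> / real (Suc m)" for x
  proof -
    have "?l * \<bar>F n x\<bar> \<le> ?l * (2 * \<bar>x\<bar>)"
      using F(2) by (intro mult_left_mono) auto
    also have "\<dots> = \<bar>x\<bar> / real (Suc m)"
      by (simp add: divide_simps)
    finally show ?thesis .
  qed
  have "(LINT \<omega>|P. exp (- ?l * (LINT x|\<gamma> \<omega>. \<bar>F n x\<bar>))) = (LINT \<omega>|P. exp (- (LINT x|\<gamma> \<omega>. ?l * \<bar>F n x\<bar>)))"
    by simp
  also have "\<dots> = exp (- (LINT x|\<alpha>. ln (1 + ?l * \<bar>F n x\<bar>)))"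
    by (rule gamma_process_laplace_simple[OF \<alpha>D(1,2) gp simple_function_compose1[OF F(1)]]) simp
  also have "\<dots> \<ge> c m"
    unfolding c_def exp_le_cancel_iff neg_le_iff_le
  proof (rule integral_mono')
    show "integrable \<alpha> (\<lambda>x. ln (1 + \<bar>x\<bar> / real (Suc m)))" by (rule int)
    show "ln (1 + ?l * \<bar>F n x\<bar>) \<le> ln (1 + \<bar>x\<bar> / real (Suc m))" for x
      using le[of x] by (subst ln_le_cancel_iff) (auto intro!: add_pos_nonneg)
    show "0 \<le> ln (1 + \<bar>x\<bar> / real (Suc m))" for x
      by simp
  qed
  finally show "c m \<le> (LINT \<omega>|P. exp (- ?l * (LINT x|\<gamma> \<omega>. \<bar>F n x\<bar>)))" .
  have "(\<lambda>m. LINT x|\<alpha>. ln (1 + \<bar>x\<bar> / real (Suc m))) \<longlonglongrightarrow> (LINT x|\<alpha>. 0)"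
  proof (rule integral_dominated_convergence[OF _ _ \<alpha>D(4)])
    have "(\<lambda>m. ln (1 + \<bar>x\<bar> / real (Suc m))) \<longlonglongrightarrow> ln (1 + 0)" for x :: real
      by (intro tendsto_ln tendsto_add tendsto_const real_tendsto_divide_at_top[OF tendsto_const]
            filterlim_compose[OF filterlim_real_sequentially filterlim_Suc]) auto
    then show "AE x in \<alpha>. (\<lambda>m. ln (1 + \<bar>x\<bar> / real (Suc m))) \<longlonglongrightarrow> 0"
      by simp
    show "AE x in \<alpha>. norm (ln (1 + \<bar>x\<bar> / real (Suc m))) \<le> ln (1 + \<bar>x\<bar>)" for m
      using bound by auto
  qed auto
  then have "(\<lambda>m. exp (- (LINT x|\<alpha>. ln (1 + \<bar>x\<bar> / real (Suc m))))) \<longlonglongrightarrow> exp (- 0)"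
    by (intro tendsto_exp tendsto_minus) simp
  then show "c \<longlonglongrightarrow> 1"
    by (simp add: c_def)
qed

lemma gamma_process_AE_integrable:
  assumes \<alpha>: "\<alpha> \<in> log_integrable_measures a" and gp: "gamma_process \<alpha> P \<gamma>"
  shows "AE \<omega> in P. integrable (\<gamma> \<omega>) (\<lambda>x. x)"
proof -
  obtain F :: "nat \<Rightarrow> real \<Rightarrow> real" where F: "\<And>n. simple_function borel (F n)"
    "\<And>x. (\<lambda>n. F n x) \<longlonglongrightarrow> x" "\<And>n x. \<bar>F n x\<bar> \<le> 2 * \<bar>x\<bar>"
    using identity_approximation by blast
  have [measurable]: "F n \<in> borel_measurable borel" for n
    using F(1) by (rule borel_measurable_simple_function)
  have rP: "random_finite_measure P \<gamma>" and pP: "prob_space P"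
    using gp by (auto simp: gamma_process_def)
  have "AE \<omega> in P. \<not> \<not> integrable (\<gamma> \<omega>) (\<lambda>x. x)"
  proof (rule AE_not_diverging[OF pP, where X = "\<lambda>n \<omega>. LINT x|\<gamma> \<omega>. \<bar>F n x\<bar>"])
    show "(\<lambda>\<omega>. LINT x|\<gamma> \<omega>. \<bar>F n x\<bar>) \<in> borel_measurable P" for n
      by (rule integral_random_measure_measurable[OF rP]) measurable
    show "Measurable.pred P (\<lambda>\<omega>. \<not> integrable (\<gamma> \<omega>) (\<lambda>x. x))"
      by (intro pred_intros_logic integral_random_measure_measurable[OF rP]) measurable
    show "filterlim (\<lambda>n. LINT x|\<gamma> \<omega>. \<bar>F n x\<bar>) at_top sequentially"
      if "\<omega> \<in> space P" "\<not> integrable (\<gamma> \<omega>) (\<lambda>x. x)" for \<omega>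
      using that rP by (intro integral_abs_diverges F) (auto simp: random_finite_measure_def)
    show "exp (- (LINT x|\<alpha>. ln (1 + \<bar>x\<bar> / real (Suc m)))) \<le>
      (LINT \<omega>|P. exp (- (1 / (2 * real (Suc m))) * (LINT x|\<gamma> \<omega>. \<bar>F n x\<bar>)))" for m n
      by (rule gamma_process_laplace_lower_bound(1)[OF \<alpha> gp F(1,3)])
    show "(\<lambda>m. exp (- (LINT x|\<alpha>. ln (1 + \<bar>x\<bar> / real (Suc m))))) \<longlonglongrightarrow> 1"
      by (rule gamma_process_laplace_lower_bound(2)[OF \<alpha> gp F(1,3)])
  qed auto
  then show ?thesis by simp
qed

text \<open>
  The Laplace bound is inherited from the gamma process through the identity in law for simple
  functions; the almost surely positive factor \<open>t\<close> does not affect divergence.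
\<close>

lemma dirichlet_process_AE_integrable:
  assumes a: "0 < a" and \<alpha>: "\<alpha> \<in> log_integrable_measures a"
    and gp: "gamma_process \<alpha> P \<gamma>" and dp: "dirichlet_process \<alpha> Q \<phi>"
  shows "AE v in Q. integrable (\<phi> v) (\<lambda>x. x)"
proof -
  note \<alpha>D = log_integrable_measuresD[OF \<alpha>]
  obtain F :: "nat \<Rightarrow> real \<Rightarrow> real" where F: "\<And>n. simple_function borel (F n)"
    "\<And>x. (\<lambda>n. F n x) \<longlonglongrightarrow> x" "\<And>n x. \<bar>F n x\<bar> \<le> 2 * \<bar>x\<bar>"
    using identity_approximation by blast
  have [measurable]: "F n \<in> borel_measurable borel" for n
    using F(1) by (rule borel_measurable_simple_function)
  have rP: "random_finite_measure P \<gamma>"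
    using gp by (auto simp: gamma_process_def)
  have rQ: "random_finite_measure Q \<phi>" and pQ: "prob_space Q"
    using dp by (auto simp: dirichlet_process_def intro: prob_algebra_random_finite_measure)
  let ?G = "gamma_distribution a"
  interpret G: prob_space ?G using a by (intro prob_space_gamma_distribution) simp
  interpret Q: prob_space Q by fact
  interpret GQ: pair_prob_space ?G Q ..
  have [measurable]: "(\<lambda>v. LINT x|\<phi> v. \<bar>F n x\<bar>) \<in> borel_measurable Q"
    "(\<lambda>\<omega>. LINT x|\<gamma> \<omega>. \<bar>F n x\<bar>) \<in> borel_measurable P" for n
    by (intro integral_random_measure_measurable[OF rQ] integral_random_measure_measurable[OF rP]; measurable)+
  have [measurable]: "Measurable.pred Q (\<lambda>v. integrable (\<phi> v) (\<lambda>x. x))"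
    by (rule integral_random_measure_measurable[OF rQ]) measurable
  have law: "distr P borel (\<lambda>\<omega>. LINT x|\<gamma> \<omega>. \<bar>F n x\<bar>) =
    distr (?G \<Otimes>\<^sub>M Q) borel (\<lambda>(t, v). t * (LINT x|\<phi> v. \<bar>F n x\<bar>))" for n
    using gamma_law_simple_function[OF \<alpha>D(1,2) _ gp dp simple_function_compose1[OF F(1), of abs]] a
    by (simp add: \<alpha>D(3))
  \<comment> \<open>The absolute value makes the sequence nonnegative everywhere and changes it only on a null set.\<close>
  have "AE p in ?G \<Otimes>\<^sub>M Q. \<not> (0 < fst p \<and> \<not> integrable (\<phi> (snd p)) (\<lambda>x. x))"
  proof (rule AE_not_diverging[where X = "\<lambda>n p. \<bar>fst p\<bar> * (LINT x|\<phi> (snd p). \<bar>F n x\<bar>)"])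
    show "prob_space (?G \<Otimes>\<^sub>M Q)" by (rule GQ.P.prob_space_axioms)
    show "filterlim (\<lambda>n. \<bar>fst p\<bar> * (LINT x|\<phi> (snd p). \<bar>F n x\<bar>)) at_top sequentially"
      if "p \<in> space (?G \<Otimes>\<^sub>M Q)" "0 < fst p \<and> \<not> integrable (\<phi> (snd p)) (\<lambda>x. x)" for p
    proof (rule filterlim_tendsto_pos_mult_at_top[OF tendsto_const])
      show "filterlim (\<lambda>n. LINT x|\<phi> (snd p). \<bar>F n x\<bar>) at_top sequentially"
        using that rQ
        by (intro integral_abs_diverges F) (auto simp: random_finite_measure_def space_pair_measure)
    qed (use that in auto)
    show "exp (- (LINT x|\<alpha>. ln (1 + \<bar>x\<bar> / real (Suc m)))) \<le>
      (LINT p|(?G \<Otimes>\<^sub>M Q). exp (- (1 / (2 * real (Suc m))) * (\<bar>fst p\<bar> * (LINT x|\<phi> (snd p). \<bar>F n x\<bar>))))" for m n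
    proof -
      let ?l = "1 / (2 * real (Suc m))"
      have "exp (- (LINT x|\<alpha>. ln (1 + \<bar>x\<bar> / real (Suc m)))) \<le>
        (LINT \<omega>|P. exp (- ?l * (LINT x|\<gamma> \<omega>. \<bar>F n x\<bar>)))"
        by (rule gamma_process_laplace_lower_bound(1)[OF \<alpha> gp F(1,3)])
      also have "\<dots> = (LINT y|distr P borel (\<lambda>\<omega>. LINT x|\<gamma> \<omega>. \<bar>F n x\<bar>). exp (- ?l * y))"
        by (subst integral_distr) auto
      also have "\<dots> = (LINT p|(?G \<Otimes>\<^sub>M Q). exp (- ?l * (fst p * (LINT x|\<phi> (snd p). \<bar>F n x\<bar>))))"
        unfolding law by (subst integral_distr) (auto simp: split_beta')
      also have "\<dots> = (LINT p|(?G \<Otimes>\<^sub>M Q). exp (- ?l * (\<bar>fst p\<bar> * (LINT x|\<phi> (snd p). \<bar>F n x\<bar>))))"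
      proof (rule integral_cong_AE)
        have "AE p in ?G \<Otimes>\<^sub>M Q. 0 < fst p"
          by (rule GQ.AE_pair_measure) (measurable, use AE_gamma_distribution_pos[OF a] in simp)
        then show "AE p in ?G \<Otimes>\<^sub>M Q. exp (- ?l * (fst p * (LINT x|\<phi> (snd p). \<bar>F n x\<bar>))) =
          exp (- ?l * (\<bar>fst p\<bar> * (LINT x|\<phi> (snd p). \<bar>F n x\<bar>)))"
          by eventually_elim simp
      qed measurable
      finally show ?thesis .
    qed
    show "(\<lambda>m. exp (- (LINT x|\<alpha>. ln (1 + \<bar>x\<bar> / real (Suc m))))) \<longlonglongrightarrow> 1"
      by (rule gamma_process_laplace_lower_bound(2)[OF \<alpha> gp F(1,3)])
  qed (auto intro!: mult_nonneg_nonneg)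
  then have "AE t in ?G. AE v in Q. \<not> (0 < t \<and> \<not> integrable (\<phi> v) (\<lambda>x. x))"
    using GQ.AE_pair by fastforce
  with AE_gamma_distribution_pos[OF a] have "AE t in ?G. AE v in Q. integrable (\<phi> v) (\<lambda>x. x)"
    by eventually_elim auto
  then show ?thesis
    by simp
qed

section \<open>The law of the mean of the gamma process\<close>

lemma integral_approximation_tendsto:
  assumes M: "sets M = sets borel"
    and F: "\<And>n. simple_function borel (F n)"
    "\<And>x. (\<lambda>n. F n x) \<longlonglongrightarrow> x" "\<And>n x. \<bar>F n x\<bar> \<le> 2 * \<bar>x\<bar>"
    and h[measurable]: "h \<in> borel_measurable borel" and b: "\<And>x. \<bar>h x\<bar> \<le> (1::real)"
    and int: "integrable M (\<lambda>x. x :: real)"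
  shows "(\<lambda>n. LINT x|M. F n x * h x) \<longlonglongrightarrow> (LINT x|M. x * h x)"
proof (rule integral_dominated_convergence[where w = "\<lambda>x. 2 * \<bar>x\<bar>"])
  note M[measurable_cong]
  have [measurable]: "F n \<in> borel_measurable borel" for n
    using F(1) by (rule borel_measurable_simple_function)
  show "(\<lambda>x. F n x * h x) \<in> borel_measurable M" "(\<lambda>x. x * h x) \<in> borel_measurable M" for n
    by measurable
  show "AE x in M. (\<lambda>n. F n x * h x) \<longlonglongrightarrow> x * h x"
    using F(2) by (auto intro!: tendsto_intros)
  show "AE x in M. norm (F n x * h x) \<le> 2 * \<bar>x\<bar>" for n
  proof (rule AE_I2)
    fix x
    have "\<bar>F n x\<bar> * \<bar>h x\<bar> \<le> (2 * \<bar>x\<bar>) * 1"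
      using F(3) b by (intro mult_mono) auto
    then show "norm (F n x * h x) \<le> 2 * \<bar>x\<bar>"
      by (simp add: abs_mult)
  qed
qed (use int in auto)

lemma mean_functional_approximation_tendsto:
  assumes M: "sets M = sets borel"
    and F: "\<And>n. simple_function borel (F n)"
    "\<And>x. (\<lambda>n. F n x) \<longlonglongrightarrow> x" "\<And>n x. \<bar>F n x\<bar> \<le> 2 * \<bar>x\<bar>"
    and int: "integrable M (\<lambda>x. x :: real)"
  shows "(\<lambda>n. LINT x|M. F n x) \<longlonglongrightarrow> mean_functional M"
proof -
  have h: "(\<lambda>_::real. 1) \<in> borel_measurable borel" "\<bar>1\<bar> \<le> (1::real)"
    by simp_all
  show ?thesis
    using integral_approximation_tendsto[OF M F h int] by (simp only: mult_1_right mean_functional_def)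
qed

lemma distr_eq_of_limits:
  fixes X :: "nat \<Rightarrow> 'a \<Rightarrow> real" and Y :: "nat \<Rightarrow> 'b \<Rightarrow> real"
  assumes M: "prob_space M" and N: "prob_space N"
    and Xn[measurable]: "\<And>n. X n \<in> borel_measurable M" and Yn[measurable]: "\<And>n. Y n \<in> borel_measurable N"
    and X'[measurable]: "X' \<in> borel_measurable M" and Y'[measurable]: "Y' \<in> borel_measurable N"
    and X: "AE \<omega> in M. (\<lambda>n. X n \<omega>) \<longlonglongrightarrow> X' \<omega>" and Y: "AE \<omega> in N. (\<lambda>n. Y n \<omega>) \<longlonglongrightarrow> Y' \<omega>"
    and eq: "\<And>n. distr M borel (X n) = distr N borel (Y n)"
  shows "distr M borel X' = distr N borel Y'"
proof (rule Levy_uniqueness)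
  interpret M: prob_space M by fact
  interpret N: prob_space N by fact
  show "real_distribution (distr M borel X')" "real_distribution (distr N borel Y')"
    by (auto intro: M.real_distribution_distr N.real_distribution_distr)
  show "char (distr M borel X') = char (distr N borel Y')"
  proof
    fix u
    have "(\<lambda>n. CLINT \<omega>|M. iexp (u * X n \<omega>)) \<longlonglongrightarrow> (CLINT \<omega>|M. iexp (u * X' \<omega>))"
    proof (rule integral_dominated_convergence[where w = "\<lambda>_. 1"])
      show "AE \<omega> in M. (\<lambda>n. iexp (u * X n \<omega>)) \<longlonglongrightarrow> iexp (u * X' \<omega>)"
        using X by eventually_elim (auto intro!: tendsto_intros)
    qed auto
    moreover have "(\<lambda>n. CLINT \<omega>|N. iexp (u * Y n \<omega>)) \<longlonglongrightarrow> (CLINT \<omega>|N. iexp (u * Y' \<omega>))"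
    proof (rule integral_dominated_convergence[where w = "\<lambda>_. 1"])
      show "AE \<omega> in N. (\<lambda>n. iexp (u * Y n \<omega>)) \<longlonglongrightarrow> iexp (u * Y' \<omega>)"
        using Y by eventually_elim (auto intro!: tendsto_intros)
    qed auto
    moreover have "(CLINT \<omega>|M. iexp (u * X n \<omega>)) = (CLINT \<omega>|N. iexp (u * Y n \<omega>))" for n
    proof -
      have "(CLINT y|distr M borel (X n). iexp (u * y)) = (CLINT y|distr N borel (Y n). iexp (u * y))"
        by (simp add: eq)
      then show ?thesis by (simp add: integral_distr)
    qed
    ultimately have "(CLINT \<omega>|M. iexp (u * X' \<omega>)) = (CLINT \<omega>|N. iexp (u * Y' \<omega>))"
      by (intro LIMSEQ_unique) simp_all
    then show "char (distr M borel X') u = char (distr N borel Y') u"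
      by (simp add: char_def integral_distr)
  qed
qed

lemma mean_functional_random_measure_measurable:
  assumes "random_finite_measure P \<gamma>"
  shows "(\<lambda>\<omega>. mean_functional (\<gamma> \<omega>)) \<in> borel_measurable P"
  unfolding mean_functional_def by (rule integral_random_measure_measurable[OF assms]) measurable

lemma gamma_mean_law:
  assumes a: "0 < a" and \<alpha>: "\<alpha> \<in> log_integrable_measures a"
    and gp: "gamma_process \<alpha> P \<gamma>" and dp: "dirichlet_process \<alpha> Q \<phi>"
  shows "distr P borel (\<lambda>\<omega>. mean_functional (\<gamma> \<omega>)) =
    distr (gamma_distribution a \<Otimes>\<^sub>M Q) borel (\<lambda>(t, v). t * mean_functional (\<phi> v))"
proof -
  note \<alpha>D = log_integrable_measuresD[OF \<alpha>]
  obtain F :: "nat \<Rightarrow> real \<Rightarrow> real" where F: "\<And>n. simple_function borel (F n)"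
    "\<And>x. (\<lambda>n. F n x) \<longlonglongrightarrow> x" "\<And>n x. \<bar>F n x\<bar> \<le> 2 * \<bar>x\<bar>"
    using identity_approximation by blast
  have [measurable]: "F n \<in> borel_measurable borel" for n
    using F(1) by (rule borel_measurable_simple_function)
  have rP: "random_finite_measure P \<gamma>" and pP: "prob_space P"
    using gp by (auto simp: gamma_process_def)
  have rQ: "random_finite_measure Q \<phi>" and pQ: "prob_space Q"
    using dp by (auto simp: dirichlet_process_def intro: prob_algebra_random_finite_measure)
  let ?G = "gamma_distribution a"
  interpret G: prob_space ?G using a by (intro prob_space_gamma_distribution) simp
  interpret Q: prob_space Q by fact
  interpret GQ: pair_prob_space ?G Q ..
  have [measurable]: "(\<lambda>v. LINT x|\<phi> v. F n x) \<in> borel_measurable Q"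
    "(\<lambda>\<omega>. LINT x|\<gamma> \<omega>. F n x) \<in> borel_measurable P" for n
    by (intro integral_random_measure_measurable[OF rQ] integral_random_measure_measurable[OF rP]; measurable)+
  have [measurable]: "(\<lambda>v. mean_functional (\<phi> v)) \<in> borel_measurable Q"
    "(\<lambda>\<omega>. mean_functional (\<gamma> \<omega>)) \<in> borel_measurable P"
    using rP rQ by (auto intro: mean_functional_random_measure_measurable)
  have [measurable]: "Measurable.pred Q (\<lambda>v. integrable (\<phi> v) (\<lambda>x. x))"
    by (rule integral_random_measure_measurable[OF rQ]) measurable
  have limP: "(\<lambda>n. LINT x|\<gamma> \<omega>. F n x) \<longlonglongrightarrow> mean_functional (\<gamma> \<omega>)"
    if "integrable (\<gamma> \<omega>) (\<lambda>x. x)" "\<omega> \<in> space P" for \<omega>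
    by (rule mean_functional_approximation_tendsto[OF _ F that(1)])
       (use rP that(2) in \<open>simp add: random_finite_measure_def\<close>)
  have limQ: "(\<lambda>n. LINT x|\<phi> v. F n x) \<longlonglongrightarrow> mean_functional (\<phi> v)"
    if "integrable (\<phi> v) (\<lambda>x. x)" "v \<in> space Q" for v
    by (rule mean_functional_approximation_tendsto[OF _ F that(1)])
       (use rQ that(2) in \<open>simp add: random_finite_measure_def\<close>)
  show ?thesis
  proof (rule distr_eq_of_limits[OF pP, where X = "\<lambda>n \<omega>. LINT x|\<gamma> \<omega>. F n x"
        and Y = "\<lambda>n (t, v). t * (LINT x|\<phi> v. F n x)"])
    show "prob_space (?G \<Otimes>\<^sub>M Q)" by (rule GQ.P.prob_space_axioms)
    show "AE \<omega> in P. (\<lambda>n. LINT x|\<gamma> \<omega>. F n x) \<longlonglongrightarrow> mean_functional (\<gamma> \<omega>)"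
      using gamma_process_AE_integrable[OF \<alpha> gp] AE_space[of P]
      by eventually_elim (rule limP)
    have "AE p in ?G \<Otimes>\<^sub>M Q. integrable (\<phi> (snd p)) (\<lambda>x. x)"
      by (rule GQ.AE_pair_measure) (measurable, use dirichlet_process_AE_integrable[OF a \<alpha> gp dp] in simp)
    then show "AE p in ?G \<Otimes>\<^sub>M Q. (\<lambda>n. case p of (t, v) \<Rightarrow> t * (LINT x|\<phi> v. F n x))
        \<longlonglongrightarrow> (case p of (t, v) \<Rightarrow> t * mean_functional (\<phi> v))"
      using AE_space[of "?G \<Otimes>\<^sub>M Q"]
    proof eventually_elim
      case (elim p)
      then show ?case
        by (auto simp: split_beta' space_pair_measure intro!: tendsto_mult tendsto_const limQ)
    qed
    show "distr P borel (\<lambda>\<omega>. LINT x|\<gamma> \<omega>. F n x) =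
      distr (?G \<Otimes>\<^sub>M Q) borel (\<lambda>(t, v). t * (LINT x|\<phi> v. F n x))" for n
      using gamma_law_simple_function[OF \<alpha>D(1,2) _ gp dp F(1)] a by (simp add: \<alpha>D(3))
  qed measurable
qed

section \<open>The mean has no atom at zero\<close>

lemma gamma_process_marginal:
  assumes gp: "gamma_process \<alpha> P \<gamma>" and B: "B \<in> sets borel"
  shows "distr P borel (\<lambda>\<omega>. measure (\<gamma> \<omega>) B) = gamma_distribution (measure \<alpha> B)"
proof -
  let ?C = "\<lambda>j::nat. if j = 0 then B else - B"
  have "measurable_partition 2 ?C"
    using B by (auto simp: measurable_partition_def disjoint_family_on_def lessThan_Suc numeral_2_eq_2)
  then have "\<forall>j<2. distr P borel (\<lambda>\<omega>. measure (\<gamma> \<omega>) (?C j)) = gamma_distribution (measure \<alpha> (?C j))"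
    using gp unfolding gamma_process_def by blast
  from this[rule_format, of 0] show ?thesis by simp
qed

text \<open>
  Quasi-invariance for the identity function and the weight function \<open>\<rho>\<close> times the indicator of
  \<open>B\<close>, obtained from simple functions by dominated convergence.  The constant in \<open>w\<close> normalizes the
  tilted measure, by the Laplace transform.
\<close>

lemma gamma_process_tilted_mean_law:
  fixes \<rho> :: real
  assumes \<alpha>: "\<alpha> \<in> log_integrable_measures a" and gp: "gamma_process \<alpha> P \<gamma>"
    and B[measurable]: "B \<in> sets borel" and \<rho>: "0 \<le> \<rho>"
  defines "w \<equiv> \<lambda>\<omega>. (1 + \<rho>) powr measure \<alpha> B * exp (- \<rho> * measure (\<gamma> \<omega>) B)"
  shows "distr (density P w) borel (\<lambda>\<omega>. mean_functional (\<gamma> \<omega>)) =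
    distr P borel (\<lambda>\<omega>. LINT x|\<gamma> \<omega>. x / (1 + \<rho> * indicator B x))"
proof -
  note \<alpha>D = log_integrable_measuresD[OF \<alpha>]
  interpret P: prob_space P using gp by (simp add: gamma_process_def)
  obtain F :: "nat \<Rightarrow> real \<Rightarrow> real" where F: "\<And>n. simple_function borel (F n)"
    "\<And>x. (\<lambda>n. F n x) \<longlonglongrightarrow> x" "\<And>n x. \<bar>F n x\<bar> \<le> 2 * \<bar>x\<bar>"
    using identity_approximation by blast
  have [measurable]: "F n \<in> borel_measurable borel" for n
    using F(1) by (rule borel_measurable_simple_function)
  have rP: "random_finite_measure P \<gamma>"
    using gp by (auto simp: gamma_process_def)
  have sets: "sets (\<gamma> \<omega>) = sets borel" if "\<omega> \<in> space P" for \<omega>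
    using rP that by (auto simp: random_finite_measure_def)
  let ?r = "\<lambda>x. \<rho> * indicator B x :: real"
  have r: "simple_function borel ?r" "0 \<le> ?r x" for x
    using \<rho> by (auto intro!: simple_function_mult simple_function_indicator)
  have rint: "(LINT x|\<gamma> \<omega>. ?r x) = \<rho> * measure (\<gamma> \<omega>) B" if "\<omega> \<in> space P" for \<omega>
    using sets[OF that] by simp
  have lnint: "(LINT x|\<alpha>. ln (1 + ?r x)) = ln (1 + \<rho>) * measure \<alpha> B"
  proof -
    have "(\<lambda>x. ln (1 + ?r x)) = (\<lambda>x. ln (1 + \<rho>) * indicator B x)"
      by (auto simp: indicator_def fun_eq_iff)
    then show ?thesis
      using \<alpha>D(2) by simp
  qed
  let ?K = "(1 + \<rho>) powr measure \<alpha> B"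
  have K: "?K * exp (- (LINT x|\<alpha>. ln (1 + ?r x))) = 1"
    using \<rho> by (simp add: lnint powr_def exp_minus mult.commute)
  have [measurable]: "(\<lambda>\<omega>. measure (\<gamma> \<omega>) B) \<in> borel_measurable P"
    using rP B by (simp add: random_finite_measure_def)
  have w_eq: "w \<omega> = ?K * exp (- (LINT x|\<gamma> \<omega>. ?r x))" if "\<omega> \<in> space P" for \<omega>
    by (simp only: w_def rint[OF that] mult_minus_left)
  have wm[measurable]: "w \<in> borel_measurable P"
    unfolding w_def by measurable
  have w0: "0 \<le> w \<omega>" for \<omega>
    by (simp add: w_def)
  have wK: "w \<omega> \<le> ?K" for \<omega>
    using \<rho> by (auto simp: w_def intro!: mult_left_le)
  have wint: "integrable P w"
    using w0 wK by (intro P.integrable_const_bound[where B = ?K]) auto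
  have "(LINT \<omega>|P. w \<omega>) = ?K * (LINT \<omega>|P. exp (- (LINT x|\<gamma> \<omega>. ?r x)))"
    unfolding integral_mult_right_zero[symmetric]
    by (intro Bochner_Integration.integral_cong refl w_eq)
  also have "\<dots> = 1"
    unfolding gamma_process_laplace_simple[OF \<alpha>D(1,2) gp r] using K .
  finally have w1: "(LINT \<omega>|P. w \<omega>) = 1" .
  have "emeasure (density P w) (space (density P w)) = 1"
    using wint w0 w1 by (simp add: emeasure_density nn_integral_eq_integral cong: nn_integral_cong)
  then interpret N: prob_space "density P w"
    by (rule prob_spaceI)
  have [measurable]: "(\<lambda>\<omega>. mean_functional (\<gamma> \<omega>)) \<in> borel_measurable P"
    using rP by (rule mean_functional_random_measure_measurable)
  have [measurable]: "(\<lambda>\<omega>. LINT x|\<gamma> \<omega>. x / (1 + ?r x)) \<in> borel_measurable P"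
    "(\<lambda>\<omega>. LINT x|\<gamma> \<omega>. F n x) \<in> borel_measurable P"
    "(\<lambda>\<omega>. LINT x|\<gamma> \<omega>. F n x / (1 + ?r x)) \<in> borel_measurable P" for n
    by (intro integral_random_measure_measurable[OF rP]; measurable)+
  have limF: "(\<lambda>n. LINT x|\<gamma> \<omega>. F n x) \<longlonglongrightarrow> mean_functional (\<gamma> \<omega>)"
    if "integrable (\<gamma> \<omega>) (\<lambda>x. x)" "\<omega> \<in> space P" for \<omega>
    by (rule mean_functional_approximation_tendsto[OF sets[OF that(2)] F that(1)])
  have limr: "(\<lambda>n. LINT x|\<gamma> \<omega>. F n x / (1 + ?r x)) \<longlonglongrightarrow> (LINT x|\<gamma> \<omega>. x / (1 + ?r x))"
    if "integrable (\<gamma> \<omega>) (\<lambda>x. x)" "\<omega> \<in> space P" for \<omega>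
  proof -
    have h: "(\<lambda>x. 1 / (1 + ?r x)) \<in> borel_measurable borel" "\<bar>1 / (1 + ?r x)\<bar> \<le> 1" for x
      using \<rho> by (auto simp: indicator_def)
    show ?thesis
      using integral_approximation_tendsto[OF sets[OF that(2)] F h that(1)]
      by (simp only: mult_1_right times_divide_eq_right)
  qed
  show ?thesis
  proof (rule Levy_uniqueness)
    show "real_distribution (distr (density P w) borel (\<lambda>\<omega>. mean_functional (\<gamma> \<omega>)))"
      by (rule N.real_distribution_distr) simp
    show "real_distribution (distr P borel (\<lambda>\<omega>. LINT x|\<gamma> \<omega>. x / (1 + ?r x)))"
      by (rule P.real_distribution_distr) simp
    show "char (distr (density P w) borel (\<lambda>\<omega>. mean_functional (\<gamma> \<omega>))) =
      char (distr P borel (\<lambda>\<omega>. LINT x|\<gamma> \<omega>. x / (1 + ?r x)))"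
    proof
      fix u
      have approx: "(CLINT \<omega>|P. w \<omega> *\<^sub>R iexp (u * (LINT x|\<gamma> \<omega>. F n x))) =
        (CLINT \<omega>|P. iexp (u * (LINT x|\<gamma> \<omega>. F n x / (1 + ?r x))))" for n
      proof -
        have "(CLINT \<omega>|P. w \<omega> *\<^sub>R iexp (u * (LINT x|\<gamma> \<omega>. F n x))) =
          (CLINT \<omega>|P. of_real ?K * (iexp (LINT x|\<gamma> \<omega>. u * F n x) * of_real (exp (- (LINT x|\<gamma> \<omega>. ?r x)))))"
          by (intro Bochner_Integration.integral_cong refl)
             (simp add: w_eq scaleR_conv_of_real mult_ac)
        also have "\<dots> = of_real ?K *
          (CLINT \<omega>|P. iexp (LINT x|\<gamma> \<omega>. u * F n x) * of_real (exp (- (LINT x|\<gamma> \<omega>. ?r x))))"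
          by (rule integral_mult_right_zero)
        also have "\<dots> = of_real (?K * exp (- (LINT x|\<alpha>. ln (1 + ?r x)))) *
          (CLINT \<omega>|P. iexp (LINT x|\<gamma> \<omega>. u * F n x / (1 + ?r x)))"
          by (subst gamma_process_quasi_invariance_simple[OF \<alpha>D(1,2) gp _ r])
             (auto intro: simple_function_mult F)
        also have "\<dots> = (CLINT \<omega>|P. iexp (u * (LINT x|\<gamma> \<omega>. F n x / (1 + ?r x))))"
          unfolding K by (simp flip: times_divide_eq_right)
        finally show ?thesis .
      qed
      have "(\<lambda>n. CLINT \<omega>|P. w \<omega> *\<^sub>R iexp (u * (LINT x|\<gamma> \<omega>. F n x))) \<longlonglongrightarrow>
        (CLINT \<omega>|P. w \<omega> *\<^sub>R iexp (u * mean_functional (\<gamma> \<omega>)))"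
      proof (rule integral_dominated_convergence[where w = "\<lambda>_. ?K"])
        show "AE \<omega> in P. (\<lambda>n. w \<omega> *\<^sub>R iexp (u * (LINT x|\<gamma> \<omega>. F n x))) \<longlonglongrightarrow> w \<omega> *\<^sub>R iexp (u * mean_functional (\<gamma> \<omega>))"
          using gamma_process_AE_integrable[OF \<alpha> gp] AE_space[of P]
        proof eventually_elim
          case (elim \<omega>)
          show ?case
            by (intro tendsto_scaleR tendsto_const tendsto_exp tendsto_mult tendsto_of_real limF[OF elim])
        qed
      qed (use w0 wK in auto)
      moreover have "(\<lambda>n. CLINT \<omega>|P. iexp (u * (LINT x|\<gamma> \<omega>. F n x / (1 + ?r x)))) \<longlonglongrightarrow>
        (CLINT \<omega>|P. iexp (u * (LINT x|\<gamma> \<omega>. x / (1 + ?r x))))"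
      proof (rule integral_dominated_convergence[where w = "\<lambda>_. 1"])
        show "AE \<omega> in P. (\<lambda>n. iexp (u * (LINT x|\<gamma> \<omega>. F n x / (1 + ?r x)))) \<longlonglongrightarrow>
            iexp (u * (LINT x|\<gamma> \<omega>. x / (1 + ?r x)))"
          using gamma_process_AE_integrable[OF \<alpha> gp] AE_space[of P]
        proof eventually_elim
          case (elim \<omega>)
          show ?case
            by (intro tendsto_const tendsto_exp tendsto_mult tendsto_of_real limr[OF elim])
        qed
      qed auto
      ultimately have "(CLINT \<omega>|P. w \<omega> *\<^sub>R iexp (u * mean_functional (\<gamma> \<omega>))) =
          (CLINT \<omega>|P. iexp (u * (LINT x|\<gamma> \<omega>. x / (1 + ?r x))))"
        unfolding approx by (rule LIMSEQ_unique)
      moreover have "char (distr (density P w) borel (\<lambda>\<omega>. mean_functional (\<gamma> \<omega>))) u =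
          (CLINT \<omega>|P. w \<omega> *\<^sub>R iexp (u * mean_functional (\<gamma> \<omega>)))"
        unfolding char_def using w0 by (subst integral_distr) (auto intro!: integral_density)
      moreover have "char (distr P borel (\<lambda>\<omega>. LINT x|\<gamma> \<omega>. x / (1 + ?r x))) u =
          (CLINT \<omega>|P. iexp (u * (LINT x|\<gamma> \<omega>. x / (1 + ?r x))))"
        unfolding char_def by (subst integral_distr) auto
      ultimately show "char (distr (density P w) borel (\<lambda>\<omega>. mean_functional (\<gamma> \<omega>))) u =
        char (distr P borel (\<lambda>\<omega>. LINT x|\<gamma> \<omega>. x / (1 + ?r x))) u"
        by simp
    qed
  qed
qed

text \<open>
  On a set \<open>B\<close> to one side of \<open>0\<close> no cancellation occurs, so its contribution \<open>U\<close> to the mean is almost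
  surely nonzero.  A suitable rescaling of the process on \<open>B\<close> then moves the mean away from
  \<open>0\<close>, and the rescaled law has the same null sets.
\<close>

lemma gamma_mean_no_atom_one_sided:
  assumes \<alpha>: "\<alpha> \<in> log_integrable_measures a" and gp: "gamma_process \<alpha> P \<gamma>"
    and B[measurable]: "B \<in> sets borel" and side: "B \<subseteq> {0<..} \<or> B \<subseteq> {..<0}" and pos: "0 < measure \<alpha> B"
  shows "AE \<omega> in P. mean_functional (\<gamma> \<omega>) \<noteq> 0"
proof -
  interpret P: prob_space P using gp by (simp add: gamma_process_def)
  have rP: "random_finite_measure P \<gamma>"
    using gp by (auto simp: gamma_process_def)
  let ?U = "\<lambda>\<omega>. LINT x|\<gamma> \<omega>. x * indicator B x" and ?X = "\<lambda>\<omega>. mean_functional (\<gamma> \<omega>)"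
  have [measurable]: "?X \<in> borel_measurable P"
    using rP by (rule mean_functional_random_measure_measurable)
  have [measurable]: "?U \<in> borel_measurable P"
    by (rule integral_random_measure_measurable[OF rP]) measurable
  have [measurable]: "(\<lambda>\<omega>. measure (\<gamma> \<omega>) B) \<in> borel_measurable P"
    using rP B by (simp add: random_finite_measure_def)
  have "AE y in distr P borel (\<lambda>\<omega>. measure (\<gamma> \<omega>) B). 0 < y"
    unfolding gamma_process_marginal[OF gp B] using pos by (rule AE_gamma_distribution_pos)
  then have Bpos: "AE \<omega> in P. 0 < measure (\<gamma> \<omega>) B"
    by (subst (asm) AE_distr_iff) auto
  have U0: "?U \<omega> \<noteq> 0"
    if "integrable (\<gamma> \<omega>) (\<lambda>x. x)" "\<omega> \<in> space P" "0 < measure (\<gamma> \<omega>) B" for \<omega>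
  proof
    assume U: "?U \<omega> = 0"
    have sets: "sets (\<gamma> \<omega>) = sets borel"
      using rP that(2) by (simp add: random_finite_measure_def)
    note sets[measurable_cong]
    obtain s :: real where s: "\<And>x. \<bar>x * indicator B x\<bar> = s * (x * indicator B x)"
    proof (cases "B \<subseteq> {0<..}")
      case True
      then show thesis by (intro that[of 1]) (auto simp: indicator_def)
    next
      case False
      with side have "B \<subseteq> {..<0}" by simp
      then show thesis by (intro that[of "- 1"]) (auto simp: indicator_def)
    qed
    have int: "integrable (\<gamma> \<omega>) (\<lambda>x. \<bar>x * indicator B x\<bar>)"
      using integrable_mult_indicator[OF _ that(1), of B] sets by (simp add: mult.commute)
    have "(LINT x|\<gamma> \<omega>. \<bar>x * indicator B x\<bar>) = 0"
      unfolding s using U by simp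
    then have "AE x in \<gamma> \<omega>. \<bar>x * indicator B x\<bar> = 0"
      using int by (subst (asm) integral_nonneg_eq_0_iff_AE) auto
    then have "AE x in \<gamma> \<omega>. x \<notin> B"
      by eventually_elim (use side in \<open>auto simp: indicator_def split: if_splits\<close>)
    then have "measure (\<gamma> \<omega>) B = 0"
      using sets by (intro measure_eq_0_null_sets) (simp add: AE_iff_null_sets)
    then show False using that(3) by simp
  qed
  let ?R = "distr P borel (\<lambda>\<omega>. ?X \<omega> / ?U \<omega>)"
  interpret R: prob_space ?R by (rule P.prob_space_distr) simp
  have "countable {\<theta>. measure ?R {\<theta>} \<noteq> 0}"
    by (rule R.countable_support)
  moreover have "uncountable {0<..<1::real}"
    by (rule uncountable_open_interval[THEN iffD2]) simp
  ultimately have "\<not> {0<..<1} \<subseteq> {\<theta>. measure ?R {\<theta>} \<noteq> 0}"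
    using countable_subset by blast
  then obtain \<theta> where \<theta>: "0 < \<theta>" "\<theta> < 1" "measure ?R {\<theta>} = 0"
    by auto
  \<comment> \<open>With this choice, division by \<open>1 + \<rho>\<close> on \<open>B\<close> subtracts exactly \<open>\<theta>\<close> times the contribution of \<open>B\<close>.\<close>
  define \<rho> where "\<rho> = \<theta> / (1 - \<theta>)"
  have \<rho>: "0 \<le> \<rho>" "1 - 1 / (1 + \<rho>) = \<theta>"
    using \<theta> by (auto simp: \<rho>_def field_simps)
  have "AE y in ?R. y \<noteq> \<theta>"
    using \<theta>(3) by (simp add: AE_iff_null_sets[symmetric] null_sets_def R.emeasure_eq_measure
      AE_iff_measurable[of "{\<theta>}"])
  then have ratio: "AE \<omega> in P. ?X \<omega> / ?U \<omega> \<noteq> \<theta>"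
    by (subst (asm) AE_distr_iff) auto
  let ?V = "\<lambda>\<omega>. LINT x|\<gamma> \<omega>. x / (1 + \<rho> * indicator B x)"
  have [measurable]: "?V \<in> borel_measurable P"
    by (rule integral_random_measure_measurable[OF rP]) measurable
  have "AE \<omega> in P. ?V \<omega> \<noteq> 0"
    using ratio Bpos gamma_process_AE_integrable[OF \<alpha> gp] AE_space[of P]
  proof eventually_elim
    case (elim \<omega>)
    have sets: "sets (\<gamma> \<omega>) = sets borel"
      using rP elim(4) by (simp add: random_finite_measure_def)
    have int: "integrable (\<gamma> \<omega>) (\<lambda>x. x * indicator B x)"
      using integrable_mult_indicator[OF _ elim(3), of B] sets by (simp add: mult.commute)
    have "?V \<omega> = (LINT x|\<gamma> \<omega>. x - \<theta> * (x * indicator B x))"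
      unfolding \<rho>(2)[symmetric]
      by (intro Bochner_Integration.integral_cong refl) (simp add: indicator_def algebra_simps)
    also have "\<dots> = ?X \<omega> - \<theta> * ?U \<omega>"
      using int elim(3) by (simp add: mean_functional_def)
    finally show ?case
      using elim(1) U0[OF elim(3,4,2)] by (auto simp: field_simps)
  qed
  then have "AE y in distr P borel ?V. y \<noteq> 0"
    by (subst AE_distr_iff) auto
  then have "AE \<omega> in density P (\<lambda>\<omega>. ennreal ((1 + \<rho>) powr measure \<alpha> B * exp (- \<rho> * measure (\<gamma> \<omega>) B))). ?X \<omega> \<noteq> 0"
    unfolding gamma_process_tilted_mean_law[OF \<alpha> gp B \<rho>(1), symmetric]
    by (subst (asm) AE_distr_iff) auto
  then show ?thesis
    using \<rho>(1) by (subst (asm) AE_density) auto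
qed

lemma gamma_mean_no_atom:
  assumes \<alpha>: "\<alpha> \<in> log_integrable_measures a" and gp: "gamma_process \<alpha> P \<gamma>" and nz: "measure \<alpha> {0} < a"
  shows "AE \<omega> in P. mean_functional (\<gamma> \<omega>) \<noteq> 0"
proof -
  note \<alpha>D = log_integrable_measuresD[OF \<alpha>]
  interpret \<alpha>: finite_measure \<alpha> by (rule \<alpha>D)
  have U: "(UNIV :: real set) = {..<0} \<union> {0} \<union> {0<..}" by auto
  have "a \<le> measure \<alpha> ({..<0} \<union> {0}) + measure \<alpha> {0<..}"
    unfolding \<alpha>D(3)[symmetric] U using \<alpha>D(2) by (intro measure_Un_le) auto
  also have "measure \<alpha> ({..<0} \<union> {0}) \<le> measure \<alpha> {..<0} + measure \<alpha> {0}"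
    using \<alpha>D(2) by (intro measure_Un_le) auto
  finally have "0 < measure \<alpha> {..<0} \<or> 0 < measure \<alpha> {0<..}"
    using nz by auto
  then show ?thesis
    by (elim disjE; intro gamma_mean_no_atom_one_sided[OF \<alpha> gp, of "{..<0}"]
      gamma_mean_no_atom_one_sided[OF \<alpha> gp, of "{0<..}"]) auto
qed

section \<open>The density of the mean\<close>

text \<open>
  For fixed \<open>y \<noteq> 0\<close>, the density in \<open>x\<close> of \<open>y\<close> times a gamma variable of shape \<open>a\<close>.  At \<open>y = 0\<close> the kernel
  is \<open>0\<close>, in agreement with the half-lines over which \<open>\<mu>\<close> is integrated in the final density.
\<close>

definition scaled_gamma_kernel :: "real \<Rightarrow> real \<Rightarrow> real \<Rightarrow> real" where
  "scaled_gamma_kernel a x y = gamma_density a (x / y) / \<bar>y\<bar>"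

lemma scaled_gamma_kernel_measurable[measurable]:
  "(\<lambda>(x, y). scaled_gamma_kernel a x y) \<in> borel_measurable (borel \<Otimes>\<^sub>M borel)"
  unfolding scaled_gamma_kernel_def by measurable

lemma nn_integral_scaled_gamma:
  assumes a: "0 < a" and y: "y \<noteq> 0" and A[measurable]: "A \<in> sets borel"
  shows "(\<integral>\<^sup>+t. indicator A (t * y) \<partial>gamma_distribution a) =
    (\<integral>\<^sup>+x. ennreal (scaled_gamma_kernel a x y) * indicator A x \<partial>lborel)"
proof -
  have "(\<integral>\<^sup>+t. indicator A (t * y) \<partial>gamma_distribution a) =
    (\<integral>\<^sup>+t. ennreal (gamma_density a t) * indicator A (t * y) \<partial>lborel)"
    unfolding gamma_distribution_eq_density[OF a] by (rule nn_integral_density) measurable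
  also have "\<dots> = ennreal \<bar>1 / y\<bar> *
      (\<integral>\<^sup>+x. ennreal (gamma_density a (0 + 1 / y * x)) * indicator A ((0 + 1 / y * x) * y) \<partial>lborel)"
    using y by (intro nn_integral_real_affine) auto
  also have "\<dots> = (\<integral>\<^sup>+x. ennreal \<bar>1 / y\<bar> * (ennreal (gamma_density a (x / y)) * indicator A x) \<partial>lborel)"
    using y by (subst nn_integral_cmult) auto
  also have "\<dots> = (\<integral>\<^sup>+x. ennreal (scaled_gamma_kernel a x y) * indicator A x \<partial>lborel)"
  proof (rule nn_integral_cong)
    fix x
    have "ennreal \<bar>1 / y\<bar> * ennreal (gamma_density a (x / y)) = ennreal (scaled_gamma_kernel a x y)"
      using gamma_density_nonneg[OF a]
      by (subst ennreal_mult[symmetric]) (auto simp: scaled_gamma_kernel_def)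
    then show "ennreal \<bar>1 / y\<bar> * (ennreal (gamma_density a (x / y)) * indicator A x) =
      ennreal (scaled_gamma_kernel a x y) * indicator A x"
      by (simp only: mult.assoc[symmetric])
  qed
  finally show ?thesis .
qed

lemma scaled_gamma_kernel_eq:
  assumes "x \<noteq> 0"
  shows "scaled_gamma_kernel a x y = \<bar>x\<bar> powr (a - 1) / Gamma a *
    (indicator (if x < 0 then {..<0} else {0<..}) y * (\<bar>y\<bar> powr (- a) * exp (- x / y)))"
proof (cases "0 < x / y")
  case True
  then have y: "y \<noteq> 0" "x < 0 \<longleftrightarrow> y < 0"
    using assms by (auto simp: zero_less_divide_iff)
  have xy: "x / y = \<bar>x\<bar> / \<bar>y\<bar>"
    using True by (metis abs_divide abs_of_pos)
  have "(\<bar>x\<bar> / \<bar>y\<bar>) powr (a - 1) / \<bar>y\<bar> = \<bar>x\<bar> powr (a - 1) * \<bar>y\<bar> powr (- a)"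
    using y(1) assms by (simp add: powr_divide powr_diff powr_minus field_simps)
  then have "(x / y) powr (a - 1) / \<bar>y\<bar> = \<bar>x\<bar> powr (a - 1) * \<bar>y\<bar> powr (- a)"
    by (simp add: xy)
  moreover have "scaled_gamma_kernel a x y = (x / y) powr (a - 1) / \<bar>y\<bar> * exp (- (x / y)) / Gamma a"
    using True by (simp add: scaled_gamma_kernel_def gamma_density_def)
  moreover have "indicator (if x < 0 then {..<0} else {0<..}) y = (1::real)"
    using y by (auto simp: indicator_def)
  ultimately show ?thesis
    by simp
next
  case False
  then have "y = 0 \<or> (x < 0 \<longleftrightarrow> 0 < y)"
    using assms by (auto simp: zero_less_divide_iff)
  then have "indicator (if x < 0 then {..<0} else {0<..}) y = (0::real)"
    by (auto simp: indicator_def)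
  then show ?thesis
    using False by (simp add: scaled_gamma_kernel_def gamma_density_def)
qed

lemma gamma_mean_density_eq_integral:
  assumes "x \<noteq> 0"
  shows "gamma_mean_density a \<mu> x = (LINT y|\<mu>. scaled_gamma_kernel a x y)"
proof -
  have "(LINT y|\<mu>. scaled_gamma_kernel a x y) = \<bar>x\<bar> powr (a - 1) / Gamma a *
    (LINT y|\<mu>. indicator (if x < 0 then {..<0} else {0<..}) y * (\<bar>y\<bar> powr (- a) * exp (- x / y)))"
    unfolding scaled_gamma_kernel_eq[OF assms] by (rule integral_mult_right_zero)
  moreover have "(LINT y|\<mu>. indicator {0<..} y * (\<bar>y\<bar> powr (- a) * exp (- x / y))) =
      (LINT y|\<mu>. indicator {0<..} y * (y powr (- a) * exp (- x / y)))"
    by (intro Bochner_Integration.integral_cong refl) (auto simp: indicator_def)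
  ultimately show ?thesis
    using assms by (auto simp: gamma_mean_density_def set_lebesgue_integral_def)
qed

lemma gamma_mean_density_measurable:
  assumes "finite_measure \<mu>" and sets: "sets \<mu> = sets borel"
  shows "gamma_mean_density a \<mu> \<in> borel_measurable borel"
proof -
  interpret finite_measure \<mu> by fact
  note sets[measurable_cong]
  have [measurable]: "(\<lambda>x. LINT y|\<mu>. indicator {..<0} y *\<^sub>R (\<bar>y\<bar> powr (- a) * exp (- x / y))) \<in> borel_measurable borel"
    "(\<lambda>x. LINT y|\<mu>. indicator {0<..} y *\<^sub>R (y powr (- a) * exp (- x / y))) \<in> borel_measurable borel"
    by (intro borel_measurable_lebesgue_integral; measurable)+
  show ?thesis
    unfolding gamma_mean_density_def[abs_def] set_lebesgue_integral_def by measurable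
qed

text \<open>
  Fubini exhibits the mixture of the kernels over \<open>\<mu>\<close> as a density with values in the extended nonnegative
  reals.  Its total mass \<open>1\<close> makes it finite almost everywhere, and there the Lebesgue
  integrals in the definition of the density are genuine rather than \<open>0\<close> by convention.
\<close>

lemma distr_scaled_gamma_eq_density:
  assumes a: "0 < a" and \<mu>: "prob_space \<mu>" and sets: "sets \<mu> = sets borel" and nz: "AE y in \<mu>. y \<noteq> 0"
  shows "distr (gamma_distribution a \<Otimes>\<^sub>M \<mu>) borel (\<lambda>(t, y). t * y) =
    density lborel (\<lambda>x. ennreal (gamma_mean_density a \<mu> x))"
proof -
  let ?G = "gamma_distribution a"
  interpret G: prob_space ?G using a by (intro prob_space_gamma_distribution) simp
  interpret \<mu>: prob_space \<mu> by fact
  interpret GM: pair_prob_space ?G \<mu> ..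
  interpret LM: pair_sigma_finite lborel \<mu> ..
  note sets[measurable_cong]
  let ?k = "scaled_gamma_kernel a"
  let ?q = "\<lambda>x. \<integral>\<^sup>+y. ennreal (?k x y) \<partial>\<mu>"
  have k0: "0 \<le> ?k x y" for x y
    using gamma_density_nonneg[OF a] by (simp add: scaled_gamma_kernel_def)
  have [measurable]: "?q \<in> borel_measurable borel"
    by measurable
  have dens: "distr (?G \<Otimes>\<^sub>M \<mu>) borel (\<lambda>(t, y). t * y) = density lborel ?q"
  proof (rule measure_eqI)
    fix A assume "A \<in> sets (distr (?G \<Otimes>\<^sub>M \<mu>) borel (\<lambda>(t, y). t * y))"
    then have A[measurable]: "A \<in> sets borel" by simp
    have "emeasure (distr (?G \<Otimes>\<^sub>M \<mu>) borel (\<lambda>(t, y). t * y)) A =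
        (\<integral>\<^sup>+z. indicator A z \<partial>distr (?G \<Otimes>\<^sub>M \<mu>) borel (\<lambda>(t, y). t * y))"
      by simp
    also have "\<dots> = (\<integral>\<^sup>+p. indicator A (fst p * snd p) \<partial>(?G \<Otimes>\<^sub>M \<mu>))"
      by (subst nn_integral_distr) (auto simp: split_beta')
    also have "\<dots> = (\<integral>\<^sup>+y. \<integral>\<^sup>+t. indicator A (t * y) \<partial>?G \<partial>\<mu>)"
      by (subst GM.nn_integral_snd[symmetric]) auto
    also have "\<dots> = (\<integral>\<^sup>+y. \<integral>\<^sup>+x. ennreal (?k x y) * indicator A x \<partial>lborel \<partial>\<mu>)"
      by (rule nn_integral_cong_AE) (use nz in eventually_elim, rule nn_integral_scaled_gamma[OF a _ A])
    also have "\<dots> = (\<integral>\<^sup>+x. \<integral>\<^sup>+y. ennreal (?k x y) * indicator A x \<partial>\<mu> \<partial>lborel)"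
      by (rule LM.Fubini') measurable
    also have "\<dots> = (\<integral>\<^sup>+x. ?q x * indicator A x \<partial>lborel)"
      by (intro nn_integral_cong nn_integral_multc) measurable
    also have "\<dots> = emeasure (density lborel ?q) A"
      by (simp add: emeasure_density)
    finally show "emeasure (distr (?G \<Otimes>\<^sub>M \<mu>) borel (\<lambda>(t, y). t * y)) A = emeasure (density lborel ?q) A" .
  qed simp
  also have "\<dots> = density lborel (\<lambda>x. ennreal (gamma_mean_density a \<mu> x))"
  proof (rule density_cong)
    have "prob_space (density lborel ?q)"
      unfolding dens[symmetric] by (rule GM.P.prob_space_distr) measurable
    then have "(\<integral>\<^sup>+x. ?q x \<partial>lborel) = 1"
      using prob_space.emeasure_space_1 by (fastforce simp: emeasure_density)
    then have "AE x in lborel. ?q x \<noteq> \<infinity>"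
      by (intro nn_integral_noteq_infinite) auto
    moreover have "AE x in lborel. x \<noteq> (0::real)"
      by (rule AE_lborel_singleton)
    ultimately show "AE x in lborel. ?q x = ennreal (gamma_mean_density a \<mu> x)"
    proof eventually_elim
      case (elim x)
      have [measurable]: "(\<lambda>y. ?k x y) \<in> borel_measurable \<mu>"
        by measurable
      have "integrable \<mu> (\<lambda>y. ?k x y)"
        using elim(1) k0 by (intro integrableI_nonneg) (auto simp: less_top)
      then show ?case
        using k0 by (simp add: gamma_mean_density_eq_integral[OF elim(2)] nn_integral_eq_integral)
    qed
  next
    show "(\<lambda>x. ennreal (gamma_mean_density a \<mu> x)) \<in> borel_measurable lborel"
      using gamma_mean_density_measurable[OF \<mu>.finite_measure_axioms sets] by simp
  qed simp
  finally show ?thesis .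
qed

theorem proposition1:
  fixes a :: real and \<alpha> :: "real measure"
    and P :: "'w measure" and \<gamma> :: "'w \<Rightarrow> real measure"
    and Q :: "'v measure" and \<phi> :: "'v \<Rightarrow> real measure"
  assumes "0 < a"
    and "\<alpha> \<in> log_integrable_measures a"
    and "0 \<le> measure \<alpha> {0}" and "measure \<alpha> {0} < a"
    and "gamma_process \<alpha> P \<gamma>"
    and "dirichlet_process \<alpha> Q \<phi>"
  shows "absolutely_continuous lborel (distr P borel (\<lambda>\<omega>. mean_functional (\<gamma> \<omega>))) \<and>
    distributed P lborel (\<lambda>\<omega>. mean_functional (\<gamma> \<omega>))
      (\<lambda>x. ennreal (gamma_mean_density a (dirichlet_mean_law Q \<phi>) x))"
proof -
  let ?G = "gamma_distribution a" and ?\<mu> = "dirichlet_mean_law Q \<phi>"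
  let ?X = "\<lambda>\<omega>. mean_functional (\<gamma> \<omega>)" and ?M = "\<lambda>v. mean_functional (\<phi> v)"
  have rP: "random_finite_measure P \<gamma>" and pP: "prob_space P"
    using assms(5) by (auto simp: gamma_process_def)
  have rQ: "random_finite_measure Q \<phi>" and pQ: "prob_space Q"
    using assms(6) by (auto simp: dirichlet_process_def intro: prob_algebra_random_finite_measure)
  interpret P: prob_space P by fact
  interpret Q: prob_space Q by fact
  interpret G: prob_space ?G using assms(1) by (intro prob_space_gamma_distribution) simp
  interpret GQ: pair_prob_space ?G Q ..
  have [measurable]: "?X \<in> borel_measurable P" "?M \<in> borel_measurable Q"
    using rP rQ by (auto intro: mean_functional_random_measure_measurable)
  have \<mu>: "prob_space ?\<mu>" "sets ?\<mu> = sets borel"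
    unfolding dirichlet_mean_law_def by (auto intro: Q.prob_space_distr)
  have law: "distr P borel ?X = distr (?G \<Otimes>\<^sub>M Q) borel (\<lambda>(t, v). t * ?M v)"
    by (rule gamma_mean_law[OF assms(1,2,5,6)])
  \<comment> \<open>The absence of an atom at \<open>0\<close> passes from \<open>\<gamma>(I)\<close> to the Dirichlet mean through the identity in law.\<close>
  have "AE z in distr P borel ?X. z \<noteq> 0"
    using gamma_mean_no_atom[OF assms(2,5,4)] by (subst AE_distr_iff) auto
  then have "AE p in ?G \<Otimes>\<^sub>M Q. fst p * ?M (snd p) \<noteq> 0"
    unfolding law by (subst (asm) AE_distr_iff) (auto simp: split_beta')
  then have "AE t in ?G. AE v in Q. t * ?M v \<noteq> 0"
    using GQ.AE_pair by fastforce
  then have "AE t in ?G. AE v in Q. ?M v \<noteq> 0"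
    by eventually_elim auto
  then have "AE v in Q. ?M v \<noteq> 0"
    by simp
  then have nz: "AE y in ?\<mu>. y \<noteq> 0"
    unfolding dirichlet_mean_law_def by (subst AE_distr_iff) auto
  have "?G \<Otimes>\<^sub>M ?\<mu> = distr ?G borel (\<lambda>t. t) \<Otimes>\<^sub>M distr Q borel ?M"
    unfolding dirichlet_mean_law_def by (simp add: distr_id2)
  also have "\<dots> = distr (?G \<Otimes>\<^sub>M Q) (borel \<Otimes>\<^sub>M borel) (\<lambda>(t, v). (t, ?M v))"
    using \<mu>(1) unfolding dirichlet_mean_law_def
    by (intro pair_measure_distr prob_space_imp_sigma_finite) auto
  finally have "distr (?G \<Otimes>\<^sub>M ?\<mu>) borel (\<lambda>(t, y). t * y) = distr (?G \<Otimes>\<^sub>M Q) borel (\<lambda>(t, v). t * ?M v)"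
    by (simp add: distr_distr o_def split_beta')
  then have dens: "distr P borel ?X = density lborel (\<lambda>x. ennreal (gamma_mean_density a ?\<mu> x))"
    using distr_scaled_gamma_eq_density[OF assms(1) \<mu> nz] law by simp
  have [measurable]: "gamma_mean_density a ?\<mu> \<in> borel_measurable borel"
    using \<mu> by (intro gamma_mean_density_measurable) (auto simp: prob_space_def)
  have "absolutely_continuous lborel (distr P borel ?X)"
    unfolding dens by (rule absolutely_continuousI_density) measurable
  moreover have "distributed P lborel ?X (\<lambda>x. ennreal (gamma_mean_density a ?\<mu> x))"
    unfolding distributed_def dens[symmetric] by (auto intro!: distr_cong)
  ultimately show ?thesis ..
qed

end
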